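(* Let $s\in\mathbb{N}$ and let $\mathbf{Y}=(Y_i)_{i\in\mathbb{Z}}$ be a stationary and ergodic sequence of random vectors in $\mathbb{R}^s$ with $\mathbb{E}\|Y_1\|^2<\infty$ and mean $\mu_Y=\mathbb{E}[Y_1]$, such that $\mathbb{E}[Y_1Y_1^\top]$ is positive definite. Let $(X_i)_{i\in\mathbb{N}}$ be an i.i.d. sequence of real random variables, independent of $\mathbf{Y}$, with bounded density $f$ that is continuous at $0$ with $f(0)>0$. Let $K$ be a symmetric bounded probability density on $\mathbb{R}$ with $c_2(K)=\int K^2(u)\,du<\infty$, and let $(h_n)$ be positive numbers such that $h_n\to0$, $nh_n\to\infty$ and $nh_n\,\lambda_{\max}\big(\operatorname{Cov}(\frac1n\sum_{i=1}^nY_i)\big)\to0$. Define $$\widehat r_n=\frac{1}{n\,\mathbb{E}[K(X_1/h_n)]}\sum_{i=1}^n Y_i\,K\!\left(\frac{X_i}{h_n}\right),\qquad \Sigma_n=\frac1n\sum_{i=1}^nY_iY_i^\top .$$ Then for every $0<\alpha<1$ the set $$\mathcal{C}^{\mu_Y}_{1-\alpha}(n)=\Big\{\mathbf{x}\in\mathbb{R}^s:\ nh_n\,(\widehat r_n-\mathbf{x})^\top\Sigma_n^{-1}(\widehat r_n-\mathbf{x})\le\frac{c_2(K)}{f(0)}\,\chi^2_{s,1-\alpha}\Big\}$$ is an asymptotic $(1-\alpha)100\%$ confidence region for $\mu_Y$, i.e. $\mathbb{P}(\mu_Y\in\mathcal{C}^{\mu_Y}_{1-\alpha}(n))\to1-\alpha$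 as $n\to\infty$, where $\chi^2_{s,1-\alpha}$ is the $(1-\alpha)$-quantile of the $\chi^2_s$ distribution.
   Context: $\|\cdot\|$ is the Euclidean norm; $\lambda_{\max}(A)$ is the largest eigenvalue of a symmetric matrix $A$. On the event that $\Sigma_n$ is singular (whose probability tends to $0$) the region is defined arbitrarily. *)

theory Defs
  imports "HOL-Probability.Probability"
begin

definition outer :: "real^'s \<Rightarrow> real^'s \<Rightarrow> real^'s^'s" where
  "outer v w = (\<chi> i j. v $ i * w $ j)"

definition pos_definite :: "real^'s^'s \<Rightarrow> bool" where
  "pos_definite A \<longleftrightarrow> transpose A = A \<and> (\<forall>v. v \<noteq> 0 \<longrightarrow> 0 < v \<bullet> (A *v v))"

text \<open>Meant for symmetric matrices, where the set of real eigenvalues is finite and nonempty.\<close>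
definition lambda_max :: "real^'s^'s \<Rightarrow> real" where
  "lambda_max A = Max {l. \<exists>v. v \<noteq> 0 \<and> A *v v = l *\<^sub>R v}"

definition cov_matrix :: "'a measure \<Rightarrow> ('a \<Rightarrow> real^'s) \<Rightarrow> real^'s^'s" where
  "cov_matrix M Z =
     (\<integral>\<omega>. outer (Z \<omega> - (\<integral>\<omega>'. Z \<omega>' \<partial>M)) (Z \<omega> - (\<integral>\<omega>'. Z \<omega>' \<partial>M)) \<partial>M)"

definition stationary_seq :: "'a measure \<Rightarrow> (int \<Rightarrow> 'a \<Rightarrow> 'b::topological_space) \<Rightarrow> bool" where
  "stationary_seq M Y \<longleftrightarrow>
     (\<forall>k. distr M (Pi\<^sub>M UNIV (\<lambda>_. borel)) (\<lambda>\<omega> i. Y (i + k) \<omega>) =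
          distr M (Pi\<^sub>M UNIV (\<lambda>_. borel)) (\<lambda>\<omega> i. Y i \<omega>))"

text \<open>Triviality of every measurable set of paths that is invariant under the left shift;
  used for stationary sequences only.\<close>
definition ergodic_seq :: "'a measure \<Rightarrow> (int \<Rightarrow> 'a \<Rightarrow> 'b::topological_space) \<Rightarrow> bool" where
  "ergodic_seq M Y \<longleftrightarrow>
     (\<forall>A \<in> sets (Pi\<^sub>M UNIV (\<lambda>_. borel)). (\<lambda>y i. y (i + 1)) -` A = A \<longrightarrow>
        measure M {\<omega> \<in> space M. (\<lambda>i. Y i \<omega>) \<in> A} \<in> {0, 1})"

text \<open>Independence of the \<open>\<sigma>\<close>-algebras generated by the two whole sequences. The library's
  \<open>indep_var\<close> requires both variables to have values in the same type.\<close>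
definition indep_seqs ::
  "'a measure \<Rightarrow> (nat \<Rightarrow> 'a \<Rightarrow> 'b::topological_space) \<Rightarrow> (int \<Rightarrow> 'a \<Rightarrow> 'c::topological_space) \<Rightarrow> bool"
where
  "indep_seqs M X Y \<longleftrightarrow>
     prob_space.indep_set M
       (sets (vimage_algebra (space M) (\<lambda>\<omega>. \<lambda>i\<in>{1..}. X i \<omega>) (Pi\<^sub>M {1..} (\<lambda>_. borel))))
       (sets (vimage_algebra (space M) (\<lambda>\<omega> i. Y i \<omega>) (Pi\<^sub>M UNIV (\<lambda>_. borel))))"

definition chi_square :: "nat \<Rightarrow> real measure" where
  "chi_square s =
     distr (Pi\<^sub>M {..<s} (\<lambda>_. density lborel std_normal_density)) borel (\<lambda>z. \<Sum>i<s. (z i)\<^sup>2)"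

definition quantile :: "real measure \<Rightarrow> real \<Rightarrow> real" where
  "quantile P p = Inf {x. p \<le> cdf P x}"

definition r_hat ::
  "'a measure \<Rightarrow> (real \<Rightarrow> real) \<Rightarrow> (nat \<Rightarrow> real) \<Rightarrow> (nat \<Rightarrow> 'a \<Rightarrow> real) \<Rightarrow> (int \<Rightarrow> 'a \<Rightarrow> real^'s)
     \<Rightarrow> nat \<Rightarrow> 'a \<Rightarrow> real^'s"
where
  "r_hat M K h X Y n \<omega> =
     (1 / (real n * (\<integral>\<omega>'. K (X 1 \<omega>' / h n) \<partial>M))) *\<^sub>R
     (\<Sum>i=1..n. K (X i \<omega> / h n) *\<^sub>R Y (int i) \<omega>)"

definition Sigma_hat :: "(int \<Rightarrow> 'a \<Rightarrow> real^'s) \<Rightarrow> nat \<Rightarrow> 'a \<Rightarrow> real^'s^'s" where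
  "Sigma_hat Y n \<omega> = (1 / real n) *\<^sub>R (\<Sum>i=1..n. outer (Y (int i) \<omega>) (Y (int i) \<omega>))"

end

theory Submission
  imports Defs
begin

text \<open>Write \<open>w\<^sub>n = sqrt (n h\<^sub>n) (r\<^sub>n - \<mu>)\<close>, \<open>p\<^sub>n = E (K (X\<^sub>1 / h\<^sub>n))\<close> and \<open>c = c\<^sub>2(K) / f 0\<close>. For every
  direction \<open>u\<close>, the variable \<open>u \<bullet> w\<^sub>n\<close> is a sum of \<open>u \<bullet> Y\<^sub>i\<close> weighted by small independent centred
  multiples of \<open>K (X\<^sub>i / h\<^sub>n) - p\<^sub>n\<close>, plus a bias that vanishes in \<open>L\<^sup>2\<close> by the assumption on the
  covariance. Given \<open>Y\<close>, a Lindeberg estimate replaces the characteristic function of the sum by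
  that of a Gaussian with variance asymptotic to \<open>c\<close> times the average of \<open>(u \<bullet> Y\<^sub>i)\<^sup>2\<close>, and the ergodic
  theorem identifies the limit of this average. Hence \<open>w\<^sub>n\<close> is asymptotically normal with covariance
  \<open>c S\<close>, where \<open>S = E (Y\<^sub>1 Y\<^sub>1\<^sup>T)\<close>, so \<open>w\<^sub>n\<^sup>T S\<^sup>-\<^sup>1 w\<^sub>n / c\<close> converges to \<open>\<chi>\<^sup>2\<^sub>s\<close> in law; finally
  \<open>\<Sigma>\<^sub>n \<rightarrow> S\<close>, and the inverse quadratic forms of \<open>\<Sigma>\<^sub>n\<close> and \<open>S\<close> are then multiplicatively close.\<close>

text \<open>Ergodicity gives no central limit theorem for \<open>Y\<close> itself, so the Gaussian
  fluctuation has to come from the kernel weights. Splitting \<open>K (X i / h n)\<close> into its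
  mean and a centred part isolates it: the mean part contributes \<open>sqrt (n h)\<close> times the
  error of the sample mean of \<open>Y\<close>, which is what the covariance assumption makes
  negligible; the centred part is, for frozen \<open>Y\<close>, a sum of independent terms, whatever
  the dependence inside \<open>Y\<close>. As the centring takes place in the weights and not in
  \<open>Y\<close>, the limit involves the uncentred second moment \<open>E (Y Y^T)\<close>, which
  is what \<open>Sigma_hat\<close> estimates. The constant \<open>c\<close> is the limit of the
  summed variances of the weights, \<open>h / p^2 * (p2 - p^2)\<close>, where p and p2 are the first
  two moments of \<open>K (X 1 / h)\<close>, asymptotic to \<open>f 0 * h\<close> and to
  \<open>f 0 * h\<close> times the integral of \<open>K^2\<close>. Since \<open>Y\<close> has only
  second moments, a cubic Lindeberg error would not be integrable; it is therefore truncated to a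
  quadratic one.\<close>

section \<open>Birkhoff's ergodic theorem for ergodic maps\<close>

text \<open>The maximum of the sums of \<open>F\<close> along the first \<open>1, \<dots>, n + 1\<close> points of the orbit.\<close>
fun birkhoff_max :: "('a \<Rightarrow> 'a) \<Rightarrow> ('a \<Rightarrow> real) \<Rightarrow> nat \<Rightarrow> 'a \<Rightarrow> real" where
  "birkhoff_max T F 0 y = F y"
| "birkhoff_max T F (Suc n) y = F y + max 0 (birkhoff_max T F n (T y))"

lemma birkhoff_max_mono: "birkhoff_max T F n y \<le> birkhoff_max T F (Suc n) y"
proof (induction n arbitrary: y)
  case (Suc n)
  have "max 0 (birkhoff_max T F n (T y)) \<le> max 0 (birkhoff_max T F (Suc n) (T y))"
    using Suc[of "T y"] by (rule max.mono[OF order_refl])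
  then show ?case by simp
qed simp

lemma birkhoff_max_ge: "F y \<le> birkhoff_max T F n y"
  by (cases n) auto

lemma birkhoff_sum_Suc:
  "(\<Sum>k<Suc n. F ((T ^^ k) y)) = F y + (\<Sum>k<n. F ((T ^^ k) (T y)) :: real)"
  by (subst sum.lessThan_Suc_shift) (simp add: funpow_swap1)

lemma birkhoff_sum_le_max: "(\<Sum>k<Suc n. F ((T ^^ k) y)) \<le> birkhoff_max T F n y"
proof (induction n arbitrary: y)
  case (Suc n)
  show ?case
    using Suc[of "T y"] by (subst birkhoff_sum_Suc) (auto simp del: sum.lessThan_Suc)
qed simp

text \<open>Ergodicity tests strictly invariant sets only, which is the form that
  \<open>ergodic_seq\<close> supplies.\<close>

locale ergodic_map = prob_space N for N :: "'a measure" +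
  fixes T :: "'a \<Rightarrow> 'a"
  assumes T_meas [measurable]: "T \<in> measurable N N"
    and T_distr: "distr N N T = N"
    and ergodic: "\<And>A. A \<in> sets N \<Longrightarrow> T -` A \<inter> space N = A \<Longrightarrow> measure N A \<in> {0, 1}"
begin

lemma funpow_meas [measurable]: "(T ^^ k) \<in> measurable N N"
  by (induction k) (auto intro: measurable_comp[of _ N N _ N])

lemma integrable_comp:
  fixes F :: "'a \<Rightarrow> real"
  assumes "integrable N F"
  shows "integrable N (\<lambda>y. F (T y))"
  using assms integrable_distr[of T N N F] T_distr by simp

lemma integral_comp:
  fixes F :: "'a \<Rightarrow> real"
  assumes "integrable N F"
  shows "(\<integral>y. F (T y) \<partial>N) = (\<integral>y. F y \<partial>N)"
  using assms integral_distr[of T N N F] T_distr by simp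

lemma integrable_birkhoff_max:
  assumes "integrable N F"
  shows "integrable N (birkhoff_max T F n)"
proof (induction n)
  case 0
  then show ?case using assms by simp
next
  case (Suc n)
  have "integrable N (\<lambda>y. F y + max 0 (birkhoff_max T F n (T y)))"
    using assms integrable_comp[OF Suc] by auto
  then show ?case by simp
qed

text \<open>A zero-one argument. Moving one step along the orbit changes the sums by the single term
  \<open>F y\<close>, so the set where they are unbounded is invariant and has measure 0 or 1.
  Measure 1 is excluded by a maximal ergodic argument, which would force a nonnegative mean.\<close>

lemma birkhoff_sums_bounded_above:
  fixes F :: "'a \<Rightarrow> real"
  assumes F: "integrable N F" and neg: "(\<integral>y. F y \<partial>N) < 0"
  shows "AE y in N. \<exists>C. \<forall>n. (\<Sum>k<n. F ((T ^^ k) y)) \<le> C"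
proof -
  have [measurable]: "F \<in> borel_measurable N" using F by auto
  define A where "A = {y \<in> space N. \<forall>m::nat. \<exists>n. (\<Sum>k<n. F ((T ^^ k) y)) > m}"
  have A_sets: "A \<in> sets N" unfolding A_def by measurable
  have inv: "T y \<in> A \<longleftrightarrow> y \<in> A" if y: "y \<in> space N" for y
  proof
    assume *: "T y \<in> A"
    show "y \<in> A" unfolding A_def
    proof (safe intro!: y)
      fix m :: nat
      obtain m' :: nat where m': "real m' \<ge> m - F y" using real_arch_simple by blast
      obtain n where "(\<Sum>k<n. F ((T ^^ k) (T y))) > m'" using * unfolding A_def by blast
      then have "(\<Sum>k<Suc n. F ((T ^^ k) y)) > m" using m' by (subst birkhoff_sum_Suc) linarith
      then show "\<exists>n. (\<Sum>k<n. F ((T ^^ k) y)) > m" by blast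
    qed
  next
    assume *: "y \<in> A"
    show "T y \<in> A" unfolding A_def
    proof (safe intro!: measurable_space[OF T_meas y])
      fix m :: nat
      obtain m' :: nat where m': "real m' \<ge> m + \<bar>F y\<bar>" using real_arch_simple by blast
      obtain n where n: "(\<Sum>k<n. F ((T ^^ k) y)) > m'" using * unfolding A_def by blast
      then obtain n' where "n = Suc n'" using m' by (cases n) auto
      then have "(\<Sum>k<n'. F ((T ^^ k) (T y))) > m" using m' n
        by (simp only: birkhoff_sum_Suc)
      then show "\<exists>n. (\<Sum>k<n. F ((T ^^ k) (T y))) > m" by blast
    qed
  qed
  have "T -` A \<inter> space N = A" using inv by (auto simp: A_def)
  then have "measure N A \<in> {0, 1}" using ergodic A_sets by blast
  moreover have "measure N A \<noteq> 1"
  proof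
    assume "measure N A = 1"
    then have AE_A: "AE y in N. y \<in> A" using A_sets by (simp add: AE_in_set_eq_1)
    let ?m = "birkhoff_max T F"
    \<comment> \<open>\<open>?D n\<close> has nonnegative integral by invariance, and decreases to \<open>F\<close> where \<open>?m n\<close> diverges.\<close>
    let ?D = "\<lambda>n y. ?m (Suc n) y - ?m n (T y)"
    have D: "?D n y = F y + max 0 (- ?m n (T y))" for n y by simp
    have im: "integrable N (?m n)" for n using integrable_birkhoff_max[OF F] .
    have "(\<lambda>n. \<integral>y. ?D n y \<partial>N) \<longlonglongrightarrow> (\<integral>y. F y \<partial>N)"
    proof (rule integral_dominated_convergence[where w = "\<lambda>y. \<bar>F y\<bar> + \<bar>F (T y)\<bar>"])
      show "(\<lambda>y. ?D n y) \<in> borel_measurable N" for n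
        using im integrable_comp[OF im] by (intro borel_measurable_diff) auto
      show "integrable N (\<lambda>y. \<bar>F y\<bar> + \<bar>F (T y)\<bar>)"
        using F integrable_comp[OF F] by auto
      \<comment> \<open>The running maximum is at least its first term \<open>F (T y)\<close>, so
        its negative part is bounded by the absolute value of that term, uniformly in
        \<open>n\<close>.\<close>
      show "AE y in N. norm (?D n y) \<le> \<bar>F y\<bar> + \<bar>F (T y)\<bar>" for n
      proof (intro AE_I2)
        fix y
        show "norm (?D n y) \<le> \<bar>F y\<bar> + \<bar>F (T y)\<bar>"
          unfolding D using birkhoff_max_ge[of F "T y" T n] by (auto simp: max_def)
      qed
      show "AE y in N. (\<lambda>n. ?D n y) \<longlonglongrightarrow> F y"
        using AE_A AE_space
      proof eventually_elim
        case (elim y)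
        then have "T y \<in> A" using inv by auto
        then obtain n where n: "(\<Sum>k<n. F ((T ^^ k) (T y))) > 0" unfolding A_def
          by (auto dest!: spec[of _ 0])
        then obtain n' where n': "n = Suc n'" by (cases n) auto
        have "?m k (T y) > 0" if "k \<ge> n'" for k
        proof -
          have "0 < ?m n' (T y)" using n birkhoff_sum_le_max[of F T "T y" n']
            unfolding n' by linarith
          also have "\<dots> \<le> ?m k (T y)"
            using that by (rule lift_Suc_mono_le[rotated]) (rule birkhoff_max_mono)
          finally show ?thesis .
        qed
        then have "F y = ?D k y" if "k \<ge> n'" for k
          using that unfolding D by (simp add: less_imp_le)
        then have "eventually (\<lambda>k. F y = ?D k y) sequentially"
          unfolding eventually_sequentially by blast
        then show ?case by (rule Lim_transform_eventually[rotated]) auto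
      qed
    qed auto
    moreover have "(\<integral>y. ?D n y \<partial>N) \<ge> 0" for n
    proof -
      have "(\<integral>y. ?D n y \<partial>N) = (\<integral>y. ?m (Suc n) y \<partial>N) - (\<integral>y. ?m n y \<partial>N)"
        by (subst Bochner_Integration.integral_diff[OF im integrable_comp[OF im]])
           (simp only: integral_comp[OF im])
      also have "\<dots> \<ge> 0"
        using integral_mono[OF im im birkhoff_max_mono, of n] by linarith
      finally show ?thesis .
    qed
    ultimately have "(\<integral>y. F y \<partial>N) \<ge> 0" by (intro LIMSEQ_le_const) auto
    then show False using neg by simp
  qed
  ultimately have "measure N A = 0" by simp
  then have "AE y in N. y \<notin> A" using A_sets by (simp add: AE_iff_measurable[where N=A] emeasure_eq_measure A_def)
  then show ?thesis
    using AE_space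
  proof eventually_elim
    case (elim y)
    then obtain m :: nat where "\<forall>n. \<not> (\<Sum>k<n. F ((T ^^ k) y)) > m" unfolding A_def by auto
    then show ?case by (auto simp: not_less)
  qed
qed

text \<open>Subtracting the mean plus \<open>e / 2\<close> from \<open>F\<close> makes the integral
  negative, so the shifted sums are bounded by some \<open>C\<close>, which costs only
  \<open>C / n\<close> in the average.\<close>

lemma birkhoff_averages_bounded_above:
  fixes F :: "'a \<Rightarrow> real"
  assumes F: "integrable N F" and e: "e > 0"
  shows "AE y in N. eventually (\<lambda>n. (\<Sum>k<n. F ((T ^^ k) y)) / n \<le> (\<integral>y. F y \<partial>N) + e) sequentially"
proof -
  define E where "E = (\<integral>y. F y \<partial>N)"
  have "AE y in N. \<exists>C. \<forall>n. (\<Sum>k<n. F ((T ^^ k) y) - (E + e / 2)) \<le> C"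
    by (rule birkhoff_sums_bounded_above) (use F e in \<open>auto simp: E_def prob_space\<close>)
  then show ?thesis
  proof eventually_elim
    case (elim y)
    then obtain C where C: "\<And>n. (\<Sum>k<n. F ((T ^^ k) y) - (E + e / 2)) \<le> C" by blast
    have C': "(\<Sum>k<n. F ((T ^^ k) y)) \<le> C + n * (E + e / 2)" for n
      using C[of n] by (simp add: sum_subtractf)
    have "(\<lambda>n::nat. C / n) \<longlonglongrightarrow> 0" by (rule lim_const_over_n)
    then have "eventually (\<lambda>n::nat. C / n < e / 2) sequentially"
      by (rule order_tendstoD) (use e in simp)
    then show ?case
      using eventually_gt_at_top[of 0]
    proof eventually_elim
      case (elim n)
      have "(\<Sum>k<n. F ((T ^^ k) y)) / n \<le> (C + n * (E + e / 2)) / n"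
        using C'[of n] by (intro divide_right_mono) auto
      also have "\<dots> = C / n + (E + e / 2)" using elim by (simp add: field_simps)
      finally show ?case using elim unfolding E_def by linarith
    qed
  qed
qed

text \<open>The upper bounds for \<open>F\<close> and for \<open>- F\<close> give the two
  inequalities; the countably many slacks \<open>1 / Suc j\<close> allow a single null set for all
  of them.\<close>

theorem birkhoff:
  fixes F :: "'a \<Rightarrow> real"
  assumes F: "integrable N F"
  shows "AE y in N. (\<lambda>n. (\<Sum>k<n. F ((T ^^ k) y)) / n) \<longlonglongrightarrow> (\<integral>y. F y \<partial>N)"
proof -
  let ?E = "\<integral>y. F y \<partial>N"
  have 1: "AE y in N. \<forall>j::nat. eventually (\<lambda>n. (\<Sum>k<n. F ((T ^^ k) y)) / n \<le> ?E + 1 / Suc j) sequentially"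
    unfolding AE_all_countable by (intro allI birkhoff_averages_bounded_above[OF F]) auto
  have 2: "AE y in N. \<forall>j::nat. eventually (\<lambda>n. (\<Sum>k<n. - F ((T ^^ k) y)) / n \<le> (\<integral>y. - F y \<partial>N) + 1 / Suc j) sequentially"
    unfolding AE_all_countable by (intro allI birkhoff_averages_bounded_above) (use F in auto)
  show ?thesis
    using 1 2
  proof eventually_elim
    case (elim y)
    show ?case
    proof (rule LIMSEQ_I)
      fix r :: real assume "r > 0"
      then obtain j where j: "1 / Suc j < r" using reals_Archimedean by (auto simp: inverse_eq_divide)
      have "eventually (\<lambda>n. \<bar>(\<Sum>k<n. F ((T ^^ k) y)) / n - ?E\<bar> < r) sequentially"
        using elim(1)[rule_format, of j] elim(2)[rule_format, of j]
        by eventually_elim (use j in \<open>simp add: sum_negf abs_less_iff\<close>)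
      then show "\<exists>no. \<forall>n\<ge>no. norm ((\<Sum>k<n. F ((T ^^ k) y)) / n - ?E) < r"
        by (auto simp: eventually_sequentially)
    qed
  qed
qed

end

text \<open>Birkhoff's theorem on path space, for the law of \<open>Y\<close> and the left shift.
  The \<open>k\<close>-th shift read at coordinate 1 is coordinate \<open>1 + k\<close>, so the
  functional \<open>g (y 1)\<close> makes the averages run over the indices
  \<open>1, ..., n\<close>.\<close>

lemma stationary_ergodic_averages:
  fixes Y :: "int \<Rightarrow> 'a \<Rightarrow> 'b::{second_countable_topology, topological_space}" and g :: "'b \<Rightarrow> real"
  assumes "prob_space M" and rv [measurable]: "\<And>i. Y i \<in> borel_measurable M"
    and st: "stationary_seq M Y" and er: "ergodic_seq M Y"
    and [measurable]: "g \<in> borel_measurable borel" and int: "integrable M (\<lambda>\<omega>. g (Y 1 \<omega>))"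
  shows "AE \<omega> in M. (\<lambda>n. (\<Sum>i=1..n. g (Y (int i) \<omega>)) / n) \<longlonglongrightarrow> (\<integral>\<omega>. g (Y 1 \<omega>) \<partial>M)"
proof -
  interpret prob_space M by fact
  let ?P = "Pi\<^sub>M UNIV (\<lambda>_::int. borel :: 'b measure)"
  let ?Z = "\<lambda>\<omega> i. Y i \<omega>"
  let ?T = "\<lambda>(y::int \<Rightarrow> 'b) i. y (i + 1)"
  have Z [measurable]: "?Z \<in> measurable M ?P"
    by (rule measurable_PiM_single') (auto simp: space_PiM)
  have T: "?T \<in> measurable ?P ?P"
    by (rule measurable_PiM_single') (auto simp: space_PiM)
  let ?N = "distr M ?P ?Z"
  interpret N: prob_space ?N by (rule prob_space_distr) fact
  interpret E: ergodic_map ?N ?T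
  proof
    show "?T \<in> measurable ?N ?N" using T by simp
    show "distr ?N ?N ?T = ?N"
      using st T by (subst distr_distr) (auto simp: stationary_seq_def comp_def cong: distr_cong)
    fix A assume A: "A \<in> sets ?N" "?T -` A \<inter> space ?N = A"
    then have "?T -` A = A" by (simp add: space_PiM)
    moreover have "measure ?N A = measure M {\<omega> \<in> space M. (\<lambda>i. Y i \<omega>) \<in> A}"
      using A(1) by (subst measure_distr[OF Z]) (auto intro!: arg_cong[where f="measure M"])
    ultimately show "measure ?N A \<in> {0, 1}" using er A by (auto simp: ergodic_seq_def)
  qed
  have [measurable]: "(\<lambda>y::int \<Rightarrow> 'b. g (y 1)) \<in> borel_measurable ?P" by measurable
  have "integrable ?N (\<lambda>y. g (y 1))"
    using int by (subst integrable_distr_eq) auto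
  from E.birkhoff[OF this] have "AE y in ?N. (\<lambda>n. (\<Sum>k<n. g ((?T ^^ k) y 1)) / n) \<longlonglongrightarrow> (\<integral>\<omega>. g (Y 1 \<omega>) \<partial>M)"
    by (subst (asm) integral_distr) auto
  then have "AE \<omega> in M. (\<lambda>n. (\<Sum>k<n. g ((?T ^^ k) (\<lambda>i. Y i \<omega>) 1)) / n) \<longlonglongrightarrow> (\<integral>\<omega>. g (Y 1 \<omega>) \<partial>M)"
    by (rule AE_distrD[OF Z])
  moreover have "(?T ^^ k) y i = y (i + int k)" for k y i
    by (induction k arbitrary: i) (auto simp: algebra_simps)
  then have "(\<Sum>k<n. g ((?T ^^ k) (\<lambda>i. Y i \<omega>) 1)) = (\<Sum>i=1..n. g (Y (int i) \<omega>))" for n \<omega>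
    by (intro sum.reindex_bij_witness[of _ "\<lambda>i. i - 1" Suc]) (auto simp: of_nat_diff)
  ultimately show ?thesis by simp
qed

section \<open>Quadratic forms\<close>

lemma symmetric_inner:
  fixes A :: "real^'s^'s"
  assumes "transpose A = A"
  shows "v \<bullet> (A *v w) = (A *v v) \<bullet> w"
  using assms by (metis dot_lmul_matrix vector_transpose_matrix)

text \<open>Eigenvectors of distinct eigenvalues are orthogonal, hence independent, so their number
  is bounded by the dimension. Finiteness is what makes the \<open>Max\<close> in
  \<open>lambda_max\<close> meaningful.\<close>

lemma finite_real_eigenvalues:
  fixes A :: "real^'s^'s"
  assumes "transpose A = A"
  shows "finite {l. \<exists>v. v \<noteq> 0 \<and> A *v v = l *\<^sub>R v}" (is "finite ?E")
proof -
  define v where "v l = (SOME v. v \<noteq> 0 \<and> A *v v = l *\<^sub>R v)" for l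
  have v: "v l \<noteq> 0" "A *v v l = l *\<^sub>R v l" if "l \<in> ?E" for l
    using that someI_ex[of "\<lambda>v. v \<noteq> 0 \<and> A *v v = l *\<^sub>R v"] unfolding v_def by blast+
  have orth: "v l \<bullet> v m = 0" if "l \<in> ?E" "m \<in> ?E" "l \<noteq> m" for l m
  proof -
    have "m * (v l \<bullet> v m) = l * (v l \<bullet> v m)"
      using symmetric_inner[OF assms, of "v l" "v m"] v(2) that by simp
    then show ?thesis using that by simp
  qed
  have inj: "inj_on v ?E"
  proof (rule inj_onI, rule ccontr)
    fix l m assume "l \<in> ?E" "m \<in> ?E" "v l = v m" "l \<noteq> m"
    then have "v l \<bullet> v l = 0" using orth[of l m] by simp
    then show False using v(1) \<open>l \<in> ?E\<close> by simp
  qed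
  have "pairwise orthogonal (v ` ?E)"
    unfolding pairwise_def orthogonal_def using orth by (metis (no_types, lifting) imageE)
  moreover have "0 \<notin> v ` ?E"
    using v(1) by (metis (no_types, lifting) imageE)
  ultimately have "independent (v ` ?E)" by (rule pairwise_orthogonal_independent)
  then have "finite (v ` ?E)" using independent_bound by blast
  then show ?thesis using inj finite_imageD by blast
qed

text \<open>The quadratic form attains a maximum \<open>l\<close> on the unit sphere, and a
  maximizer is an eigenvector with eigenvalue \<open>l\<close>; hence \<open>l\<close> is at most
  the largest eigenvalue.\<close>

lemma le_lambda_max:
  fixes A :: "real^'s^'s"
  assumes sym: "transpose A = A"
  shows "v \<bullet> (A *v v) \<le> lambda_max A * (v \<bullet> v)"
proof -
  define S where "S = sphere (0::real^'s) 1"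
  have "continuous_on S (\<lambda>v. v \<bullet> (A *v v))"
    by (intro continuous_intros matrix_vector_mult_linear_continuous_on)
  moreover have "compact S" by (simp add: S_def)
  moreover have "axis undefined 1 \<in> S" by (simp add: S_def)
  ultimately obtain x where x: "x \<in> S" and max: "\<And>v. v \<in> S \<Longrightarrow> v \<bullet> (A *v v) \<le> x \<bullet> (A *v x)"
    using continuous_attains_sup[of S] by blast
  define l where "l = x \<bullet> (A *v x)"
  have xx: "x \<bullet> x = 1" using x by (simp add: S_def dot_square_norm)
  have le: "v \<bullet> (A *v v) \<le> l * (v \<bullet> v)" for v
  proof (cases "v = 0")
    case False
    have "(inverse (norm v) *\<^sub>R v) \<bullet> (A *v (inverse (norm v) *\<^sub>R v)) \<le> l"
      unfolding l_def by (rule max) (use False in \<open>simp add: S_def\<close>)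
    then have "inverse (norm v) * (inverse (norm v) * (v \<bullet> (A *v v))) \<le> l"
      by (simp add: matrix_vector_mult_scaleR)
    then have "(v \<bullet> (A *v v)) / (v \<bullet> v) \<le> l"
      by (simp add: dot_square_norm power2_eq_square field_simps)
    then show ?thesis using False by (simp add: pos_divide_le_eq)
  qed simp
  \<comment> \<open>First-order condition at the maximizer: along \<open>x + t w\<close> the defect
    is the quadratic \<open>2 t a + t^2 b\<close>, which is never positive, so its linear
    coefficient \<open>a\<close> vanishes.\<close>
  have "w \<bullet> (A *v x - l *\<^sub>R x) = 0" for w
  proof -
    define a where "a = w \<bullet> (A *v x - l *\<^sub>R x)"
    define b where "b = w \<bullet> (A *v w) - l * (w \<bullet> w)"
    have b: "b \<le> 0" using le[of w] by (simp add: b_def)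
    have "2 * t * a + t\<^sup>2 * b \<le> 0" for t
    proof -
      have "w \<bullet> (A *v x) = x \<bullet> (A *v w)"
        using symmetric_inner[OF sym, of w x] by (simp add: inner_commute)
      then have "(x + t *\<^sub>R w) \<bullet> (A *v (x + t *\<^sub>R w)) - l * ((x + t *\<^sub>R w) \<bullet> (x + t *\<^sub>R w)) = 2 * t * a + t\<^sup>2 * b"
        unfolding a_def b_def
        by (simp add: matrix_vector_right_distrib matrix_vector_mult_scaleR inner_simps xx
           l_def[symmetric] algebra_simps power2_eq_square inner_commute[of x w])
      then show ?thesis using le[of "x + t *\<^sub>R w"] by simp
    qed
    note nonpos = this
    have neg: "2 * r * a\<^sup>2 + r * (r * b) * a\<^sup>2 \<le> 0" for r
      using nonpos[of "a * r"] by (simp add: power2_eq_square algebra_simps)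
    \<comment> \<open>Chosen so that \<open>r * b = r - 1\<close>; then \<open>2 r + r^2 b\<close>
      becomes \<open>r * (1 + r) > 0\<close>, with no case distinction on
      \<open>b = 0\<close>.\<close>
    define r where "r = 1 / (1 - b)"
    have "r > 0" "r * b = r - 1" using b by (auto simp: r_def field_simps)
    from neg[of r] have "a\<^sup>2 * (r * (1 + r)) \<le> 0"
      unfolding \<open>r * b = r - 1\<close> by (simp add: algebra_simps)
    moreover have "r * (1 + r) > 0" using \<open>r > 0\<close> by simp
    ultimately have "a\<^sup>2 \<le> 0" by (metis mult_le_0_iff not_less)
    then show ?thesis by (simp add: a_def)
  qed
  then have "A *v x - l *\<^sub>R x = 0" by (metis inner_eq_zero_iff)
  moreover have "x \<noteq> 0" using xx by auto
  ultimately have "l \<in> {l. \<exists>v. v \<noteq> 0 \<and> A *v v = l *\<^sub>R v}" by auto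
  then have "l \<le> lambda_max A"
    unfolding lambda_max_def by (intro Max_ge finite_real_eigenvalues[OF sym])
  then show ?thesis using le[of v] by (meson inner_ge_zero mult_right_mono order_trans)
qed

text \<open>A substitute for a square root of the inverse of \<open>S\<close>: if \<open>B\<close>
  has the columns \<open>b i\<close>, the condition reads \<open>B^T S B = 1\<close>, whence
  \<open>B B^T\<close> is that inverse. Natural number indices match the coordinates in
  \<open>chi_square\<close>.\<close>

definition quad_orthonormal :: "real^'s^'s \<Rightarrow> (nat \<Rightarrow> real^'s) \<Rightarrow> bool" where
  "quad_orthonormal S b \<longleftrightarrow>
     (\<forall>i<CARD('s). \<forall>j<CARD('s). b i \<bullet> (S *v b j) = (if i = j then 1 else 0))"

text \<open>Gram-Schmidt without explicit projections: as long as fewer vectors than the dimension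
  have been found, some nonzero \<open>w\<close> is Euclidean orthogonal to all
  \<open>S *v b i\<close>, and it only has to be normalized.\<close>

lemma ex_quad_orthonormal:
  fixes S :: "real^'s^'s"
  assumes "pos_definite S"
  shows "\<exists>b. quad_orthonormal S b"
proof -
  have sym: "transpose S = S" and pos: "\<And>v. v \<noteq> 0 \<Longrightarrow> 0 < v \<bullet> (S *v v)"
    using assms by (auto simp: pos_definite_def)
  have "\<exists>b. \<forall>i<k. \<forall>j<k. b i \<bullet> (S *v b j) = (if i = j then 1 else 0)" if "k \<le> CARD('s)" for k
    using that
  proof (induction k)
    case (Suc k)
    then obtain b where b: "\<And>i j. i < k \<Longrightarrow> j < k \<Longrightarrow> b i \<bullet> (S *v b j) = (if i = j then 1 else 0)"
      by fastforce
    let ?W = "(\<lambda>i. S *v b i) ` {..<k}"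
    have "dim ?W \<le> card ?W" by (intro dim_le_card') auto
    also have "\<dots> \<le> card {..<k}" by (rule card_image_le) simp
    also have "\<dots> < DIM(real^'s)" using Suc.prems by simp
    finally obtain w where w: "w \<noteq> 0" "\<And>y. y \<in> span ?W \<Longrightarrow> orthogonal w y"
      using orthogonal_to_subspace_exists[of ?W] by auto
    have wb: "w \<bullet> (S *v b i) = 0" if "i < k" for i
      using w(2)[of "S *v b i"] that by (auto simp: orthogonal_def intro: span_base)
    then have bw: "b i \<bullet> (S *v w) = 0" if "i < k" for i
      using that symmetric_inner[OF sym, of "b i" w] by (simp add: inner_commute)
    define q where "q = w \<bullet> (S *v w)"
    have q: "q > 0" using pos w by (simp add: q_def)
    let ?b = "b(k := (1 / sqrt q) *\<^sub>R w)"
    have "?b i \<bullet> (S *v ?b j) = (if i = j then 1 else 0)" if "i < Suc k" "j < Suc k" for i j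
      using that b wb bw q
      by (auto simp: less_Suc_eq matrix_vector_mult_scaleR q_def[symmetric])
    then show ?case by blast
  qed simp
  then show ?thesis unfolding quad_orthonormal_def by blast
qed

text \<open>The sum is the inverse of \<open>S\<close> applied to \<open>w\<close>. The defect
  \<open>z\<close> is orthogonal to every \<open>b i\<close>, and these are as many independent
  vectors as the dimension, so they span the space and \<open>z = 0\<close>.\<close>

lemma quad_orthonormal_dual:
  fixes S :: "real^'s^'s"
  assumes b: "quad_orthonormal S b"
  shows "S *v (\<Sum>j<CARD('s). (b j \<bullet> w) *\<^sub>R b j) = w"
proof -
  have o: "b i \<bullet> (S *v b j) = (if i = j then 1 else 0)" if "i < CARD('s)" "j < CARD('s)" for i j
    using b that by (auto simp: quad_orthonormal_def)
  have inj: "inj_on b {..<CARD('s)}"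
  proof (rule inj_onI)
    fix i j assume "i \<in> {..<CARD('s)}" "j \<in> {..<CARD('s)}" "b i = b j"
    then show "i = j" using o[of i j] o[of j j] by (auto split: if_splits)
  qed
  have "independent (b ` {..<CARD('s)})"
  proof (subst independent_explicit_finite_subsets, safe)
    fix T u v assume T: "T \<subseteq> b ` {..<CARD('s)}" "finite T" and s: "(\<Sum>v\<in>T. u v *\<^sub>R v) = 0" and v: "v \<in> T"
    obtain i where i: "i < CARD('s)" "v = b i" using T v by auto
    have "0 = (\<Sum>v\<in>T. u v *\<^sub>R v) \<bullet> (S *v b i)" using s by simp
    also have "\<dots> = (\<Sum>x\<in>T. u x * (x \<bullet> (S *v b i)))" by (simp add: inner_sum_left)
    also have "\<dots> = (\<Sum>x\<in>T. if x = v then u v else 0)"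
    proof (rule sum.cong[OF refl])
      fix x assume "x \<in> T"
      then obtain j where j: "j < CARD('s)" "x = b j" using T by auto
      then show "u x * (x \<bullet> (S *v b i)) = (if x = v then u v else 0)"
        using o[of j i] i inj by (auto simp: inj_on_def)
    qed
    also have "\<dots> = u v" using T v by simp
    finally show "u v = 0" by simp
  qed
  then have span: "span (b ` {..<CARD('s)}) = UNIV"
    using card_image[OF inj] by (intro dim_eq_full[THEN iffD1]) (simp add: dim_eq_card_independent)
  define z where "z = S *v (\<Sum>j<CARD('s). (b j \<bullet> w) *\<^sub>R b j) - w"
  have Sy: "S *v (\<Sum>j<CARD('s). (b j \<bullet> w) *\<^sub>R b j) = (\<Sum>j<CARD('s). (b j \<bullet> w) *\<^sub>R (S *v b j))"
    by (simp add: linear_sum[OF matrix_vector_mul_linear] matrix_vector_mult_scaleR o_def)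
  have "orthogonal z (b i)" if "i < CARD('s)" for i
    using that by (simp add: z_def Sy orthogonal_def inner_commute[of _ "b i"] inner_diff_right
        inner_sum_right o if_distrib[of "\<lambda>x. _ * x"] cong: if_cong)
  then have "orthogonal z z"
    using span orthogonal_to_span[of z "b ` {..<CARD('s)}" z] by auto
  then show ?thesis by (simp add: z_def orthogonal_def)
qed

lemma matrix_mul_matrix_inv:
  fixes A :: "real^'s^'s"
  assumes "invertible A"
  shows "A ** matrix_inv A = mat 1"
  using assms unfolding invertible_def matrix_inv_def by (rule someI2_ex) blast

text \<open>Both bounds come from expanding a nonnegative quadratic form at a scaled difference of
  \<open>A\<^sup>-\<^sup>1 w\<close> and \<open>S\<^sup>-\<^sup>1 w\<close>; the sum is \<open>w\<^sup>T S\<^sup>-\<^sup>1 w\<close>.\<close>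
lemma quad_inverse_sandwich:
  fixes A S :: "real^'s^'s"
  assumes S: "pos_definite S" and b: "quad_orthonormal S b"
    and d: "0 \<le> d" "d < 1" and close: "\<And>v. \<bar>v \<bullet> (A *v v) - v \<bullet> (S *v v)\<bar> \<le> d * (v \<bullet> (S *v v))"
  shows "invertible A"
    and "(1 - d) * (w \<bullet> (matrix_inv A *v w)) \<le> (\<Sum>j<CARD('s). (b j \<bullet> w)\<^sup>2)"
    and "transpose A = A \<Longrightarrow> (\<Sum>j<CARD('s). (b j \<bullet> w)\<^sup>2) \<le> (1 + d) * (w \<bullet> (matrix_inv A *v w))"
proof -
  have sym: "transpose S = S" and pos: "\<And>v. v \<noteq> 0 \<Longrightarrow> 0 < v \<bullet> (S *v v)"
    using S by (auto simp: pos_definite_def)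
  have lo: "(1 - d) * (v \<bullet> (S *v v)) \<le> v \<bullet> (A *v v)" and up: "v \<bullet> (A *v v) \<le> (1 + d) * (v \<bullet> (S *v v))" for v
    using close[of v] by (auto simp: algebra_simps abs_le_iff)
  show inv: "invertible A"
  proof -
    have "v = 0" if "A *v v = 0" for v
    proof (rule ccontr)
      assume "v \<noteq> 0"
      then have "0 < (1 - d) * (v \<bullet> (S *v v))" using pos d by simp
      then show False using lo[of v] that by simp
    qed
    then show ?thesis by (simp add: invertible_left_inverse matrix_left_invertible_ker)
  qed
  define x where "x = matrix_inv A *v w"
  have Ax: "A *v x = w" using inv by (simp add: x_def matrix_vector_mul_assoc matrix_mul_matrix_inv)
  define y where "y = (\<Sum>j<CARD('s). (b j \<bullet> w) *\<^sub>R b j)"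
  have Sy: "S *v y = w" using quad_orthonormal_dual[OF b] by (simp add: y_def)
  define V where "V = (\<Sum>j<CARD('s). (b j \<bullet> w)\<^sup>2)"
  have V: "V = w \<bullet> y" by (simp add: V_def y_def inner_sum_right power2_eq_square inner_commute)
  have V': "V = y \<bullet> (S *v y)" by (simp add: V Sy inner_commute)
  define q where "q = w \<bullet> (matrix_inv A *v w)"
  have q: "q = w \<bullet> x" "q = x \<bullet> (A *v x)" by (simp_all add: q_def x_def[symmetric] Ax inner_commute)
  show "(1 - d) * q \<le> V"
  proof -
    \<comment> \<open>With this factor \<open>lo\<close> bounds the leading term by
      \<open>(1 - d) * q\<close>; the cross term is \<open>- 2 * (1 - d) * q\<close>, and
      \<open>V - (1 - d) * q\<close> remains.\<close>
    let ?z = "(1 - d) *\<^sub>R x - y"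
    have "0 \<le> ?z \<bullet> (S *v ?z)" using pos[of ?z] by (cases "?z = 0") auto
    also have "\<dots> = (1 - d)\<^sup>2 * (x \<bullet> (S *v x)) - 2 * (1 - d) * q + V"
      using symmetric_inner[OF sym, of y x]
      by (simp add: matrix_vector_mult_diff_distrib matrix_vector_mult_scaleR inner_simps Sy
          V q(1) power2_eq_square inner_commute algebra_simps)
    also have "(1 - d)\<^sup>2 * (x \<bullet> (S *v x)) \<le> (1 - d) * q"
      using mult_left_mono[OF lo[of x], of "1 - d"] d q(2) by (simp add: power2_eq_square mult.assoc)
    finally show ?thesis by (simp add: algebra_simps)
  qed
  assume symA: "transpose A = A"
  have posA: "0 \<le> v \<bullet> (A *v v)" for v
    using lo[of v] pos[of v] d by (cases "v = 0") (auto intro: order_trans[rotated])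
  show "V \<le> (1 + d) * q"
  proof -
    \<comment> \<open>The roles of the forms are exchanged: now \<open>up\<close> bounds the term in
      \<open>y\<close>. The form is that of \<open>A\<close>, so the two cross terms agree by the
      symmetry of \<open>A\<close>.\<close>
    let ?z = "(1 + d) *\<^sub>R x - y"
    have "0 \<le> ?z \<bullet> (A *v ?z)" by (rule posA)
    also have "\<dots> = (1 + d)\<^sup>2 * q - 2 * (1 + d) * V + y \<bullet> (A *v y)"
      using symmetric_inner[OF symA, of x y]
      by (simp add: matrix_vector_mult_diff_distrib matrix_vector_mult_scaleR inner_simps Ax
          V q(1) power2_eq_square inner_commute algebra_simps)
    also have "y \<bullet> (A *v y) \<le> (1 + d) * V" using up[of y] V' by simp
    finally have "(1 + d) * V \<le> (1 + d) * ((1 + d) * q)" by (simp add: algebra_simps power2_eq_square)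
    then show ?thesis using d by simp
  qed
qed

text \<open>Compactness of the unit sphere: the minimum of the form there is attained, hence
  positive, and scaling does the rest.\<close>

lemma pos_definite_bound:
  fixes S :: "real^'s^'s"
  assumes S: "pos_definite S"
  shows "\<exists>l>0. \<forall>v. l * (v \<bullet> v) \<le> v \<bullet> (S *v v)"
proof -
  define U where "U = sphere (0::real^'s) 1"
  have "continuous_on U (\<lambda>v. v \<bullet> (S *v v))"
    by (intro continuous_intros matrix_vector_mult_linear_continuous_on)
  moreover have "compact U" by (simp add: U_def)
  moreover have "axis undefined 1 \<in> U" by (simp add: U_def)
  ultimately obtain x where x: "x \<in> U" and min: "\<And>v. v \<in> U \<Longrightarrow> x \<bullet> (S *v x) \<le> v \<bullet> (S *v v)"
    using continuous_attains_inf[of U] by blast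
  define l where "l = x \<bullet> (S *v x)"
  have "x \<noteq> 0" using x by (auto simp: U_def)
  then have "l > 0" using S by (simp add: l_def pos_definite_def)
  moreover have "l * (v \<bullet> v) \<le> v \<bullet> (S *v v)" for v
  proof (cases "v = 0")
    case False
    have "l \<le> (inverse (norm v) *\<^sub>R v) \<bullet> (S *v (inverse (norm v) *\<^sub>R v))"
      unfolding l_def by (rule min) (use False in \<open>simp add: U_def\<close>)
    then have "l \<le> inverse (norm v) * (inverse (norm v) * (v \<bullet> (S *v v)))"
      by (simp add: matrix_vector_mult_scaleR)
    then have "l \<le> (v \<bullet> (S *v v)) / (v \<bullet> v)"
      by (simp add: dot_square_norm power2_eq_square field_simps)
    then show ?thesis using False by (simp add: pos_le_divide_eq)
  qed simp
  ultimately show ?thesis by blast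
qed

lemma quad_form_close:
  fixes S :: "real^'s^'s"
  assumes S: "pos_definite S" and d: "d > 0"
  shows "\<exists>e>0. \<forall>A. norm (A - S) \<le> e \<longrightarrow> (\<forall>v. \<bar>v \<bullet> (A *v v) - v \<bullet> (S *v v)\<bar> \<le> d * (v \<bullet> (S *v v)))"
proof -
  obtain l where l: "l > 0" "\<And>v. l * (v \<bullet> v) \<le> v \<bullet> (S *v v)" using pos_definite_bound[OF S] by blast
  \<comment> \<open>The squared dimension compensates the passage from an entrywise bound to the
    operator norm; \<open>l\<close> turns the Euclidean square into the form of \<open>S\<close>,
    which makes the error relative.\<close>
  define e where "e = d * l / (real CARD('s) * real CARD('s))"
  have "\<bar>v \<bullet> (A *v v) - v \<bullet> (S *v v)\<bar> \<le> d * (v \<bullet> (S *v v))" if A: "norm (A - S) \<le> e" for A and v :: "real^'s"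
  proof -
    have comp: "\<bar>(A - S) $ i $ j\<bar> \<le> e" for i j
    proof -
      have "\<bar>(A - S) $ i $ j\<bar> \<le> norm ((A - S) $ i)" by (rule component_le_norm_cart)
      also have "\<dots> \<le> norm (A - S)" by (rule Finite_Cartesian_Product.norm_nth_le)
      finally show ?thesis using A by simp
    qed
    have "\<bar>v \<bullet> (A *v v) - v \<bullet> (S *v v)\<bar> = \<bar>v \<bullet> ((A - S) *v v)\<bar>"
      by (simp add: matrix_vector_mult_diff_rdistrib inner_diff_right)
    also have "\<dots> \<le> norm v * norm ((A - S) *v v)" by (rule Cauchy_Schwarz_ineq2)
    also have "\<dots> \<le> norm v * (onorm ((*v) (A - S)) * norm v)"
      by (intro mult_left_mono onorm) (simp_all add: matrix_vector_mul_bounded_linear)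
    also have "\<dots> \<le> norm v * ((real CARD('s) * real CARD('s) * e) * norm v)"
      by (intro mult_left_mono mult_right_mono onorm_le_matrix_component comp) simp_all
    also have "\<dots> = d * (l * (v \<bullet> v))"
      by (simp add: e_def dot_square_norm power2_eq_square)
    also have "\<dots> \<le> d * (v \<bullet> (S *v v))" using l(2) d by (intro mult_left_mono) auto
    finally show ?thesis .
  qed
  moreover have "e > 0" using l d by (simp add: e_def)
  ultimately show ?thesis by blast
qed

section \<open>Kernel averages and the Lindeberg estimate\<close>

text \<open>Substituting \<open>x = h n * u\<close> moves the bandwidth into the argument of
  \<open>f\<close>; then dominated convergence applies, with continuity at 0 for the pointwise limit
  and boundedness of \<open>f\<close> for the domination.\<close>

lemma approximate_identity_tendsto:
  fixes f G :: "real \<Rightarrow> real"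
  assumes f [measurable]: "f \<in> borel_measurable borel" and B: "bounded (range f)" and cont: "isCont f 0"
    and G: "integrable lborel G" and h: "h \<longlonglongrightarrow> 0" and pos: "\<And>n::nat. n \<ge> 1 \<Longrightarrow> 0 < h n"
  shows "(\<lambda>n. (\<integral>x. f x * G (x / h n) \<partial>lborel) / h n) \<longlonglongrightarrow> f 0 * (\<integral>u. G u \<partial>lborel)"
proof -
  obtain b where b: "\<And>x. \<bar>f x\<bar> \<le> b" using B by (auto simp: bounded_iff)
  have [measurable]: "G \<in> borel_measurable borel" using G by auto
  have "(\<lambda>n. \<integral>u. f (h n * u) * G u \<partial>lborel) \<longlonglongrightarrow> (\<integral>u. f 0 * G u \<partial>lborel)"
  proof (rule integral_dominated_convergence[where w = "\<lambda>u. b * \<bar>G u\<bar>"])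
    show "AE u in lborel. (\<lambda>n. f (h n * u) * G u) \<longlonglongrightarrow> f 0 * G u"
      by (intro AE_I2 tendsto_mult isCont_tendsto_compose[OF cont] tendsto_const)
         (use tendsto_mult_right[OF h] in auto)
    show "AE u in lborel. norm (f (h n * u) * G u) \<le> b * \<bar>G u\<bar>" for n
      using b by (auto simp: abs_mult intro!: mult_right_mono)
  qed (use G in auto)
  moreover have "eventually (\<lambda>n. (\<integral>u. f (h n * u) * G u \<partial>lborel) = (\<integral>x. f x * G (x / h n) \<partial>lborel) / h n) sequentially"
    using eventually_ge_at_top[of 1]
  proof eventually_elim
    case (elim n)
    then have "h n > 0" by (rule pos)
    then show ?case
      by (subst lborel_integral_real_affine[of "h n" "\<lambda>x. f x * G (x / h n)" 0]) auto
  qed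
  ultimately show ?thesis by (simp add: filterlim_cong)
qed

text \<open>Both functions lie within \<open>v * (t^2 * min 1 (|t| * e))\<close> of
  \<open>1 - t^2 v / 2\<close>, hence the factor 2. The minimum matters because \<open>t\<close> is
  later replaced by a random weight with only a second moment: it keeps the error below a multiple
  of \<open>t^2\<close>.\<close>

lemma (in prob_space) char_quadratic_approx:
  fixes X :: "'a \<Rightarrow> real"
  assumes [measurable]: "X \<in> borel_measurable M" and bound: "\<And>\<omega>. \<bar>X \<omega>\<bar> \<le> e"
    and mean: "expectation X = 0" and var: "expectation (\<lambda>\<omega>. (X \<omega>)\<^sup>2) = v"
  shows "cmod (char (distr M borel X) t - exp (- (t\<^sup>2 * v / 2))) \<le> 2 * v * (t\<^sup>2 * min 1 (\<bar>t\<bar> * e))"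
proof -
  have e: "e \<ge> 0" using bound[of undefined] by simp
  have sq: "(X \<omega>)\<^sup>2 \<le> e\<^sup>2" for \<omega> using bound[of \<omega>] by (metis abs_ge_zero power_mono power2_abs)
  have int: "integrable M X" "integrable M (\<lambda>\<omega>. (X \<omega>)\<^sup>2)"
    by (rule integrable_const_bound[of _ e] integrable_const_bound[of _ "e\<^sup>2"]; use bound sq in auto)+
  have v: "v \<ge> 0" "v \<le> e\<^sup>2" unfolding var[symmetric]
    using integral_mono[OF int(2), of "\<lambda>_. e\<^sup>2"] sq by (auto simp: prob_space)
  have "cmod (char (distr M borel X) t - (1 - t\<^sup>2 * v / 2)) \<le>
      (t\<^sup>2 / 6) * expectation (\<lambda>x. min (6 * (X x)\<^sup>2) (\<bar>t\<bar> * \<bar>X x\<bar>^3))"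
    by (rule char_approx3'[of X]) (use int mean var in auto)
  also have "\<dots> \<le> (t\<^sup>2 / 6) * expectation (\<lambda>x. (X x)\<^sup>2 * (6 * min 1 (\<bar>t\<bar> * e)))"
  proof (intro mult_left_mono integral_mono)
    show "integrable M (\<lambda>x. (X x)\<^sup>2 * (6 * min 1 (\<bar>t\<bar> * e)))" using int by auto
    show "integrable M (\<lambda>x. min (6 * (X x)\<^sup>2) (\<bar>t\<bar> * \<bar>X x\<bar>^3))"
      by (rule Bochner_Integration.integrable_bound[of _ "\<lambda>x. 6 * (X x)\<^sup>2"]) (use int in auto)
    fix \<omega>
    have "\<bar>t\<bar> * \<bar>X \<omega>\<bar>^3 = (X \<omega>)\<^sup>2 * (\<bar>t\<bar> * \<bar>X \<omega>\<bar>)" by (simp add: eval_nat_numeral)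
    also have "\<dots> \<le> (X \<omega>)\<^sup>2 * (\<bar>t\<bar> * e)" using bound by (intro mult_left_mono) auto
    also have "\<dots> \<le> (X \<omega>)\<^sup>2 * (6 * (\<bar>t\<bar> * e))" using e by (intro mult_left_mono) auto
    finally have "min (6 * (X \<omega>)\<^sup>2) (\<bar>t\<bar> * \<bar>X \<omega>\<bar> ^ 3) \<le> min ((X \<omega>)\<^sup>2 * 6) ((X \<omega>)\<^sup>2 * (6 * (\<bar>t\<bar> * e)))"
      by (intro min.mono) auto
    also have "\<dots> = (X \<omega>)\<^sup>2 * (6 * min 1 (\<bar>t\<bar> * e))" by (simp add: mult_min_right)
    finally show "min (6 * (X \<omega>)\<^sup>2) (\<bar>t\<bar> * \<bar>X \<omega>\<bar> ^ 3) \<le> (X \<omega>)\<^sup>2 * (6 * min 1 (\<bar>t\<bar> * e))" .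
  qed simp
  also have "\<dots> = v * (t\<^sup>2 * min 1 (\<bar>t\<bar> * e))" using var by simp
  finally have 1: "cmod (char (distr M borel X) t - (1 - t\<^sup>2 * v / 2)) \<le> v * (t\<^sup>2 * min 1 (\<bar>t\<bar> * e))" .
  define y where "y = t\<^sup>2 * v / 2"
  have y: "y \<ge> 0" using v by (simp add: y_def)
  have "\<bar>exp (- y) - (1 - y)\<bar> \<le> y * min 2 y"
  proof -
    have "exp (- y) \<ge> 1 - y" using exp_ge_add_one_self[of "- y"] by simp
    moreover have "exp (- y) \<le> 1" using y by simp
    \<comment> \<open>Multiply by \<open>exp y\<close>, which is at least \<open>1 + y\<close>, and
      use that \<open>(1 - y + y^2) * (1 + y) = 1 + y^3\<close> is at least 1.\<close>
    moreover have "exp (- y) \<le> 1 - y + y\<^sup>2"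
    proof -
      have "(1 - y + y\<^sup>2) * exp y \<ge> (1 - y + y\<^sup>2) * (1 + y)"
        using y zero_le_power2[of "y - 1"] by (intro mult_left_mono exp_ge_add_one_self) (auto simp: power2_eq_square algebra_simps)
      moreover have "(1 - y + y\<^sup>2) * (1 + y) = 1 + y^3" by (simp add: eval_nat_numeral algebra_simps)
      ultimately have "1 \<le> (1 - y + y\<^sup>2) * exp y" using y by (metis add_increasing2 order_trans le_add_same_cancel1 zero_le_power)
      then show ?thesis by (simp add: exp_minus inverse_eq_divide pos_divide_le_eq)
    qed
    ultimately have "\<bar>exp (- y) - (1 - y)\<bar> \<le> y * 2" "\<bar>exp (- y) - (1 - y)\<bar> \<le> y * y"
      using y unfolding power2_eq_square abs_le_iff by linarith+
    then show ?thesis by (simp add: min_def)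
  qed
  also have "y * min 2 y \<le> y * (2 * min 1 (\<bar>t\<bar> * e))"
  proof (intro mult_left_mono y)
    \<comment> \<open>A variable bounded by \<open>e\<close> has variance at most
      \<open>e^2\<close>; this expresses the Gaussian error through the same quantity
      \<open>|t| * e\<close>.\<close>
    have te: "2 * y \<le> (\<bar>t\<bar> * e)\<^sup>2" using v by (simp add: y_def power_mult_distrib mult_left_mono)
    show "min 2 y \<le> 2 * min 1 (\<bar>t\<bar> * e)"
    proof (cases "\<bar>t\<bar> * e \<le> 1")
      case True
      have "(\<bar>t\<bar> * e)\<^sup>2 \<le> \<bar>t\<bar> * e" using True e by (simp add: power2_eq_square mult_left_le)
      then show ?thesis using True te y by linarith
    qed auto
  qed
  also have "\<dots> = v * (t\<^sup>2 * min 1 (\<bar>t\<bar> * e))" by (simp add: y_def)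
  finally have 2: "cmod (exp (- (t\<^sup>2 * v / 2)) - (1 - t\<^sup>2 * v / 2)) \<le> v * (t\<^sup>2 * min 1 (\<bar>t\<bar> * e))"
    unfolding y_def by (metis norm_of_real of_real_1 of_real_diff of_real_exp of_real_minus)
  have "cmod (char (distr M borel X) t - exp (- (t\<^sup>2 * v / 2))) \<le> v * (t\<^sup>2 * min 1 (\<bar>t\<bar> * e)) + v * (t\<^sup>2 * min 1 (\<bar>t\<bar> * e))"
    by (rule norm_diff_triangle_le[OF 1]) (use 2 in \<open>simp add: norm_minus_commute\<close>)
  then show ?thesis by simp
qed

text \<open>Conditioning on the weights without conditional expectations: the joint law of the two
  blocks is a product, so Fubini freezes the weights at \<open>b\<close>, and for fixed
  \<open>b\<close> the characteristic function of the sum factors.\<close>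

lemma (in prob_space) expectation_iexp_sum_mult:
  fixes \<xi> a :: "'i \<Rightarrow> 'a \<Rightarrow> real"
  assumes I: "finite I" and ind: "indep_vars (\<lambda>_. borel) \<xi> I"
    and ind2: "indep_var (PiM I (\<lambda>_. borel)) (\<lambda>\<omega>. \<lambda>i\<in>I. \<xi> i \<omega>) (PiM I (\<lambda>_. borel)) (\<lambda>\<omega>. \<lambda>i\<in>I. a i \<omega>)"
  shows "(CLINT \<omega>|M. iexp (\<Sum>i\<in>I. a i \<omega> * \<xi> i \<omega>)) = (CLINT \<omega>|M. (\<Prod>i\<in>I. char (distr M borel (\<xi> i)) (a i \<omega>)))"
proof -
  let ?P = "PiM I (\<lambda>_. borel :: real measure)"
  let ?X = "\<lambda>\<omega>. \<lambda>i\<in>I. \<xi> i \<omega>" and ?A = "\<lambda>\<omega>. \<lambda>i\<in>I. a i \<omega>"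
  have [measurable]: "?X \<in> measurable M ?P" "?A \<in> measurable M ?P"
    using ind2 by (auto dest: indep_var_rv1 indep_var_rv2)
  have rv [measurable]: "\<xi> i \<in> borel_measurable M" if "i \<in> I" for i
    using ind that by (auto simp: indep_vars_def)
  interpret X: prob_space "distr M ?P ?X" by (rule prob_space_distr) simp
  interpret A: prob_space "distr M ?P ?A" by (rule prob_space_distr) simp
  interpret XA: pair_prob_space "distr M ?P ?X" "distr M ?P ?A" ..
  define \<Phi> where "\<Phi> x b = iexp (\<Sum>i\<in>I. b i * x i)" for x b :: "'i \<Rightarrow> real"
  have \<Phi>_meas [measurable]: "(\<lambda>z. \<Phi> (fst z) (snd z)) \<in> borel_measurable (?P \<Otimes>\<^sub>M ?P)"
    unfolding \<Phi>_def using I by measurable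
  have joint: "distr M (?P \<Otimes>\<^sub>M ?P) (\<lambda>\<omega>. (?X \<omega>, ?A \<omega>)) = distr M ?P ?X \<Otimes>\<^sub>M distr M ?P ?A"
    using ind2 unfolding indep_var_distribution_eq by simp
  have "(CLINT \<omega>|M. iexp (\<Sum>i\<in>I. a i \<omega> * \<xi> i \<omega>)) = (CLINT \<omega>|M. \<Phi> (?X \<omega>) (?A \<omega>))"
    by (simp add: \<Phi>_def)
  also have "\<dots> = (CLINT z|distr M (?P \<Otimes>\<^sub>M ?P) (\<lambda>\<omega>. (?X \<omega>, ?A \<omega>)). \<Phi> (fst z) (snd z))"
    by (subst integral_distr) auto
  also have "\<dots> = (CLINT b|distr M ?P ?A. (CLINT x|distr M ?P ?X. \<Phi> x b))"
  proof -
    have "integrable (distr M ?P ?X \<Otimes>\<^sub>M distr M ?P ?A) (\<lambda>z. \<Phi> (fst z) (snd z))"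
      by (rule XA.P.integrable_const_bound[of _ 1]) (auto simp: \<Phi>_def)
    then show ?thesis
      unfolding joint using XA.integral_snd[of \<Phi>] by (simp add: case_prod_unfold)
  qed
  also have "\<dots> = (CLINT b|distr M ?P ?A. (\<Prod>i\<in>I. char (distr M borel (\<xi> i)) (b i)))"
  proof (rule Bochner_Integration.integral_cong[OF refl])
    fix b
    have [measurable]: "(\<lambda>x. \<Phi> x b) \<in> borel_measurable ?P"
      unfolding \<Phi>_def using I by measurable
    have "(CLINT x|distr M ?P ?X. \<Phi> x b) = (CLINT \<omega>|M. \<Phi> (?X \<omega>) b)"
      by (subst integral_distr) auto
    also have "\<dots> = char (distr M borel (\<lambda>\<omega>. \<Sum>i\<in>I. b i * \<xi> i \<omega>)) 1"
      unfolding char_def by (subst integral_distr) (use I in \<open>auto simp: \<Phi>_def\<close>)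
    also have "\<dots> = (\<Prod>i\<in>I. char (distr M borel (\<lambda>\<omega>. b i * \<xi> i \<omega>)) 1)"
      by (rule char_distr_sum) (rule indep_vars_compose2[OF ind], simp)
    also have "\<dots> = (\<Prod>i\<in>I. char (distr M borel (\<xi> i)) (b i))"
      by (intro prod.cong refl) (simp add: char_def integral_distr)
    finally show "(CLINT x|distr M ?P ?X. \<Phi> x b) = (\<Prod>i\<in>I. char (distr M borel (\<xi> i)) (b i))" .
  qed
  also have "\<dots> = (CLINT \<omega>|M. (\<Prod>i\<in>I. char (distr M borel (\<xi> i)) (?A \<omega> i)))"
  proof (rule integral_distr)
    have "char (distr M borel (\<xi> i)) \<in> borel_measurable borel" if "i \<in> I" for i
      by (rule real_distribution.char_measurable) (simp add: that real_distribution_distr)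
    then show "(\<lambda>b. \<Prod>i\<in>I. char (distr M borel (\<xi> i)) (b i)) \<in> borel_measurable ?P"
      by (intro borel_measurable_prod) (auto intro: measurable_compose[OF measurable_component_singleton])
  qed simp
  also have "\<dots> = (CLINT \<omega>|M. (\<Prod>i\<in>I. char (distr M borel (\<xi> i)) (a i \<omega>)))" by (simp cong: prod.cong)
  finally show ?thesis .
qed

text \<open>A Lindeberg comparison with random weights: for frozen weights, two products of numbers
  of modulus at most 1 differ by at most the sum of the differences of their factors. The
  \<open>a i\<close> may depend on each other in any way.\<close>

lemma (in prob_space) mixed_clt_bound:
  fixes \<xi> a :: "'i \<Rightarrow> 'a \<Rightarrow> real"
  assumes I: "finite I" and ind: "indep_vars (\<lambda>_. borel) \<xi> I"
    and ind2: "indep_var (PiM I (\<lambda>_. borel)) (\<lambda>\<omega>. \<lambda>i\<in>I. \<xi> i \<omega>) (PiM I (\<lambda>_. borel)) (\<lambda>\<omega>. \<lambda>i\<in>I. a i \<omega>)"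
    and bound: "\<And>i \<omega>. i \<in> I \<Longrightarrow> \<bar>\<xi> i \<omega>\<bar> \<le> e"
    and mean: "\<And>i. i \<in> I \<Longrightarrow> expectation (\<xi> i) = 0"
    and var: "\<And>i. i \<in> I \<Longrightarrow> expectation (\<lambda>\<omega>. (\<xi> i \<omega>)\<^sup>2) = v"
    and rv [measurable]: "\<And>i. i \<in> I \<Longrightarrow> a i \<in> borel_measurable M"
    and sq: "\<And>i. i \<in> I \<Longrightarrow> integrable M (\<lambda>\<omega>. (a i \<omega>)\<^sup>2)"
  shows "cmod ((CLINT \<omega>|M. iexp (\<Sum>i\<in>I. a i \<omega> * \<xi> i \<omega>)) - (CLINT \<omega>|M. exp (- (v / 2 * (\<Sum>i\<in>I. (a i \<omega>)\<^sup>2)))))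
    \<le> 2 * v * (\<Sum>i\<in>I. expectation (\<lambda>\<omega>. (a i \<omega>)\<^sup>2 * min 1 (\<bar>a i \<omega>\<bar> * e)))"
proof -
  let ?c = "\<lambda>i t. char (distr M borel (\<xi> i)) t"
  have \<xi> [measurable]: "\<xi> i \<in> borel_measurable M" if "i \<in> I" for i
    using ind that by (auto simp: indep_vars_def)
  have rd: "real_distribution (distr M borel (\<xi> i))" if "i \<in> I" for i
    using that by (simp add: real_distribution_distr)
  have [measurable]: "?c i \<in> borel_measurable borel" if "i \<in> I" for i
    by (rule real_distribution.char_measurable) (rule rd[OF that])
  have c1: "cmod (?c i t) \<le> 1" if "i \<in> I" for i t
    by (rule real_distribution.cmod_char_le_1) (rule rd[OF that])
  have v: "0 \<le> v" if "i \<in> I" for i unfolding var[OF that, symmetric] by simp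
  have int1: "integrable M (\<lambda>\<omega>. (\<Prod>i\<in>I. ?c i (a i \<omega>)))"
  proof (rule integrable_const_bound[of _ 1])
    show "AE \<omega> in M. cmod (\<Prod>i\<in>I. ?c i (a i \<omega>)) \<le> 1"
      by (intro AE_I2) (simp add: prod_norm[symmetric] prod_le_1 c1)
    have "(\<lambda>\<omega>. ?c i (a i \<omega>)) \<in> borel_measurable M" if "i \<in> I" for i
      using that by measurable
    then show "(\<lambda>\<omega>. \<Prod>i\<in>I. ?c i (a i \<omega>)) \<in> borel_measurable M"
      by (rule borel_measurable_prod)
  qed
  have int2: "integrable M (\<lambda>\<omega>. exp (- (v / 2 * (\<Sum>i\<in>I. (a i \<omega>)\<^sup>2))) :: complex)"
  proof (rule integrable_const_bound[of _ 1])
    show "AE \<omega> in M. cmod (exp (- (v / 2 * (\<Sum>i\<in>I. (a i \<omega>)\<^sup>2)))) \<le> 1"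
    proof (rule AE_I2)
      fix \<omega>
      have "v / 2 * (\<Sum>i\<in>I. (a i \<omega>)\<^sup>2) \<ge> 0"
        using v by (cases "I = {}") (auto intro!: mult_nonneg_nonneg sum_nonneg)
      then show "cmod (exp (- (v / 2 * (\<Sum>i\<in>I. (a i \<omega>)\<^sup>2)))) \<le> 1" by (simp add: norm_exp_eq_Re)
    qed
  qed measurable
  have int3: "integrable M (\<lambda>\<omega>. (a i \<omega>)\<^sup>2 * min 1 (\<bar>a i \<omega>\<bar> * e))" if "i \<in> I" for i
  proof (rule Bochner_Integration.integrable_bound[OF sq[OF that]])
    have "e \<ge> 0" using bound[OF that, of undefined] by simp
    then show "AE x in M. norm ((a i x)\<^sup>2 * min 1 (\<bar>a i x\<bar> * e)) \<le> norm ((a i x)\<^sup>2)"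
      by (intro AE_I2) (simp add: abs_mult mult_left_le)
    have [measurable]: "a i \<in> borel_measurable M" using rv[OF that] .
    show "(\<lambda>\<omega>. (a i \<omega>)\<^sup>2 * min 1 (\<bar>a i \<omega>\<bar> * e)) \<in> borel_measurable M" by measurable
  qed
  have "cmod ((CLINT \<omega>|M. iexp (\<Sum>i\<in>I. a i \<omega> * \<xi> i \<omega>)) - (CLINT \<omega>|M. exp (- (v / 2 * (\<Sum>i\<in>I. (a i \<omega>)\<^sup>2)))))
     = cmod (CLINT \<omega>|M. (\<Prod>i\<in>I. ?c i (a i \<omega>)) - exp (- (v / 2 * (\<Sum>i\<in>I. (a i \<omega>)\<^sup>2))))"
    unfolding expectation_iexp_sum_mult[OF I ind ind2] by (subst Bochner_Integration.integral_diff[OF int1 int2]) (rule refl)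
  also have "\<dots> \<le> expectation (\<lambda>\<omega>. cmod ((\<Prod>i\<in>I. ?c i (a i \<omega>)) - exp (- (v / 2 * (\<Sum>i\<in>I. (a i \<omega>)\<^sup>2)))))"
    by (rule integral_norm_bound)
  also have "\<dots> \<le> expectation (\<lambda>\<omega>. (\<Sum>i\<in>I. 2 * v * ((a i \<omega>)\<^sup>2 * min 1 (\<bar>a i \<omega>\<bar> * e))))"
  proof (rule integral_mono)
    show "integrable M (\<lambda>\<omega>. cmod ((\<Prod>i\<in>I. ?c i (a i \<omega>)) - exp (- (v / 2 * (\<Sum>i\<in>I. (a i \<omega>)\<^sup>2)))))"
      using int1 int2 by simp
    show "integrable M (\<lambda>\<omega>. (\<Sum>i\<in>I. 2 * v * ((a i \<omega>)\<^sup>2 * min 1 (\<bar>a i \<omega>\<bar> * e))))"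
      using int3 by simp
    fix \<omega>
    have "exp (- (v / 2 * (\<Sum>i\<in>I. (a i \<omega>)\<^sup>2))) = (\<Prod>i\<in>I. exp (- ((a i \<omega>)\<^sup>2 * v / 2)))"
      using I by (simp add: exp_sum[symmetric] sum_distrib_left sum_negf sum_divide_distrib mult.commute)
    then have "cmod ((\<Prod>i\<in>I. ?c i (a i \<omega>)) - exp (- (v / 2 * (\<Sum>i\<in>I. (a i \<omega>)\<^sup>2))))
       = cmod ((\<Prod>i\<in>I. ?c i (a i \<omega>)) - (\<Prod>i\<in>I. complex_of_real (exp (- ((a i \<omega>)\<^sup>2 * v / 2)))))" by simp
    also have "\<dots> \<le> (\<Sum>i\<in>I. cmod (?c i (a i \<omega>) - exp (- ((a i \<omega>)\<^sup>2 * v / 2))))"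
      using v c1 by (intro norm_prod_diff) (auto simp: norm_exp_eq_Re)
    also have "\<dots> \<le> (\<Sum>i\<in>I. 2 * v * ((a i \<omega>)\<^sup>2 * min 1 (\<bar>a i \<omega>\<bar> * e)))"
    proof (rule sum_mono)
      fix i assume "i \<in> I"
      then show "cmod (?c i (a i \<omega>) - exp (- ((a i \<omega>)\<^sup>2 * v / 2))) \<le> 2 * v * ((a i \<omega>)\<^sup>2 * min 1 (\<bar>a i \<omega>\<bar> * e))"
        using char_quadratic_approx[of "\<xi> i" e v "a i \<omega>"] bound mean var by simp
    qed
    finally show "cmod ((\<Prod>i\<in>I. ?c i (a i \<omega>)) - exp (- (v / 2 * (\<Sum>i\<in>I. (a i \<omega>)\<^sup>2)))) \<le> (\<Sum>i\<in>I. 2 * v * ((a i \<omega>)\<^sup>2 * min 1 (\<bar>a i \<omega>\<bar> * e)))" .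
  qed
  also have "\<dots> = 2 * v * (\<Sum>i\<in>I. expectation (\<lambda>\<omega>. (a i \<omega>)\<^sup>2 * min 1 (\<bar>a i \<omega>\<bar> * e)))"
    using int3 by (simp add: sum_distrib_left)
  finally show ?thesis .
qed

section \<open>Convergence in law to the chi-square distribution\<close>

text \<open>On a compact interval moments determine limits: a bounded continuous test function is
  replaced by a polynomial within \<open>r / 4\<close>, once under \<open>N n\<close> and once under
  \<open>L\<close>, and a further \<open>r / 4\<close> covers the convergence of the polynomial
  integrals.\<close>

lemma moments_imp_weak_conv:
  fixes N :: "nat \<Rightarrow> real measure" and L :: "real measure"
  assumes N: "\<And>n. real_distribution (N n)" and L: "real_distribution L"
    and bN: "\<And>n. AE x in N n. x \<in> {a..b}" and bL: "AE x in L. x \<in> {a..b}"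
    and moments: "\<And>k. (\<lambda>n. \<integral>x. x ^ k \<partial>N n) \<longlonglongrightarrow> (\<integral>x. x ^ k \<partial>L)"
  shows "weak_conv_m N L"
proof (rule integral_bdd_continuous_conv_imp_weak_conv[OF N L])
  fix f :: "real \<Rightarrow> real"
  assume f: "\<And>x. isCont f x" "\<And>x. \<bar>f x\<bar> \<le> 1"
  have f_meas: "f \<in> borel_measurable borel"
    using f(1) by (intro borel_measurable_continuous_onI) (simp add: continuous_at_imp_continuous_on)
  have int_pow: "integrable D (\<lambda>x. x ^ k)" if D: "real_distribution D" "AE x in D. x \<in> {a..b}" for D :: "real measure" and k
  proof -
    interpret D: real_distribution D by (rule D)
    have "AE x in D. norm (x ^ k) \<le> (max \<bar>a\<bar> \<bar>b\<bar>) ^ k"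
      using D(2) by eventually_elim (auto simp: power_abs intro!: power_mono)
    then show ?thesis by (rule D.integrable_const_bound) simp
  qed
  have int_f: "integrable D f" if D: "real_distribution D" for D :: "real measure"
  proof -
    interpret D: real_distribution D by (rule D)
    show ?thesis by (rule D.integrable_const_bound[of _ 1]) (use f f_meas in auto)
  qed
  show "(\<lambda>n. integral\<^sup>L (N n) f) \<longlonglongrightarrow> integral\<^sup>L L f"
  proof (rule LIMSEQ_I)
    fix r :: real assume r: "r > 0"
    obtain g where "real_polynomial_function g" "\<And>x. x \<in> {a..b} \<Longrightarrow> \<bar>f x - g x\<bar> < r / 4"
      using Stone_Weierstrass_real_polynomial_function[of "{a..b}" f "r / 4"] r f(1)
      by (auto simp: continuous_at_imp_continuous_on)
    then obtain c d where p: "\<And>x. x \<in> {a..b} \<Longrightarrow> \<bar>f x - (\<Sum>i\<le>d. c i * x ^ i)\<bar> < r / 4"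
      unfolding real_polynomial_function_iff_sum by fastforce
    let ?p = "\<lambda>x. \<Sum>i\<le>d. c i * x ^ i"
    have int_p: "integrable D ?p" if "real_distribution D" "AE x in D. x \<in> {a..b}" for D :: "real measure"
      using int_pow[OF that] by simp
    have close: "\<bar>integral\<^sup>L D f - integral\<^sup>L D ?p\<bar> \<le> r / 4"
      if D: "real_distribution D" "AE x in D. x \<in> {a..b}" for D :: "real measure"
    proof -
      interpret D: real_distribution D by (rule D)
      have "\<bar>integral\<^sup>L D f - integral\<^sup>L D ?p\<bar> = \<bar>\<integral>x. f x - ?p x \<partial>D\<bar>"
        by (simp add: Bochner_Integration.integral_diff[OF int_f[OF D(1)] int_p[OF D]])
      also have "\<dots> \<le> (\<integral>x. \<bar>f x - ?p x\<bar> \<partial>D)" by (rule integral_abs_bound)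
      also have "\<dots> \<le> (\<integral>x. r / 4 \<partial>D)"
      proof (rule integral_mono_AE)
        show "integrable D (\<lambda>x. \<bar>f x - ?p x\<bar>)" using int_f[OF D(1)] int_p[OF D] by simp
        show "AE x in D. \<bar>f x - ?p x\<bar> \<le> r / 4"
          using D(2) by eventually_elim (rule less_imp_le[OF p])
      qed simp
      finally show ?thesis by (simp add: D.prob_space del: D.space_eq_univ)
    qed
    have "(\<lambda>n. integral\<^sup>L (N n) ?p) \<longlonglongrightarrow> integral\<^sup>L L ?p"
      using int_pow[OF N bN] int_pow[OF L bL] by (simp add: tendsto_sum tendsto_mult_left moments)
    then obtain n0 where "\<And>n. n \<ge> n0 \<Longrightarrow> \<bar>integral\<^sup>L (N n) ?p - integral\<^sup>L L ?p\<bar> < r / 4"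
      using LIMSEQ_D[of _ _ "r / 4"] r by fastforce
    then have "\<bar>integral\<^sup>L (N n) f - integral\<^sup>L L f\<bar> < r" if "n \<ge> n0" for n
      using close[OF N bN, of n] close[OF L bL] that[THEN \<open>\<And>n. n \<ge> n0 \<Longrightarrow> _\<close>] r by linarith
    then show "\<exists>n0. \<forall>n\<ge>n0. norm (integral\<^sup>L (N n) f - integral\<^sup>L L f) < r" by auto
  qed
qed

text \<open>The variable \<open>- exp (- x)\<close> is bounded, increasing in \<open>x\<close>, and its moments are values of the
  Laplace transform at the natural numbers.\<close>
lemma laplace_imp_weak_conv:
  fixes N :: "nat \<Rightarrow> real measure" and L :: "real measure"
  assumes N: "\<And>n. real_distribution (N n)" and L: "real_distribution L"
    and pN: "\<And>n. AE x in N n. 0 \<le> x" and pL: "AE x in L. 0 \<le> x"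
    and laplace: "\<And>k::nat. (\<lambda>n. \<integral>x. exp (- (real k * x)) \<partial>N n) \<longlonglongrightarrow> (\<integral>x. exp (- (real k * x)) \<partial>L)"
  shows "weak_conv_m N L"
proof -
  let ?u = "\<lambda>x::real. - exp (- x)"
  let ?D = "\<lambda>D. distr D borel ?u"
  have rd: "real_distribution (?D D)" if "real_distribution D" for D
  proof -
    interpret D: real_distribution D by (rule that)
    show ?thesis by (rule D.real_distribution_distr) simp
  qed
  have supp: "AE x in ?D D. x \<in> {-1..0}" if "real_distribution D" "AE x in D. 0 \<le> x" for D :: "real measure"
  proof -
    interpret D: real_distribution D by (rule that)
    show ?thesis using that(2) by (subst AE_distr_iff) auto
  qed
  have mom: "(\<integral>x. x ^ k \<partial>?D D) = (-1) ^ k * (\<integral>x. exp (- (real k * x)) \<partial>D)" if "real_distribution D" for D k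
  proof -
    interpret D: real_distribution D by (rule that)
    have "(- exp (- x)) ^ k = (-1) ^ k * exp (- (real k * x))" for x :: real
      by (metis exp_of_nat_mult mult_minus_right power_minus)
    then show ?thesis by (subst integral_distr) auto
  qed
  \<comment> \<open>As \<open>?u\<close> is strictly increasing, it carries over values of the cdf
    and atoms. Continuity points are points without atoms, so those of \<open>cdf L\<close> go to
    continuity points of the transformed cdf.\<close>
  have cdf: "cdf (?D D) (- exp (- x)) = cdf D x" and atom: "measure (?D D) {- exp (- x)} = measure D {x}"
    if "real_distribution D" for D x
  proof -
    interpret D: real_distribution D by (rule that)
    show "cdf (?D D) (- exp (- x)) = cdf D x"
      unfolding cdf_def by (subst measure_distr) (auto intro!: arg_cong[where f="measure D"])
    show "measure (?D D) {- exp (- x)} = measure D {x}"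
      by (subst measure_distr) (auto intro!: arg_cong[where f="measure D"])
  qed
  have wc: "weak_conv_m (\<lambda>n. ?D (N n)) (?D L)"
    by (rule moments_imp_weak_conv[OF rd[OF N] rd[OF L] supp[OF N pN] supp[OF L pL]])
       (simp add: mom[OF N] mom[OF L] tendsto_mult_left laplace)
  show ?thesis
    unfolding weak_conv_m_def weak_conv_def
  proof safe
    fix x assume "isCont (cdf L) x"
    interpret L: real_distribution L by (rule L)
    interpret DL: real_distribution "?D L" by (rule rd[OF L])
    have "isCont (cdf (?D L)) (- exp (- x))"
      using \<open>isCont (cdf L) x\<close> unfolding DL.isCont_cdf L.isCont_cdf atom[OF L] .
    then have "(\<lambda>n. cdf (?D (N n)) (- exp (- x))) \<longlonglongrightarrow> cdf (?D L) (- exp (- x))"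
      using wc by (simp add: weak_conv_m_def weak_conv_def)
    then show "(\<lambda>n. cdf (N n) x) \<longlonglongrightarrow> cdf L x" by (simp add: cdf[OF N] cdf[OF L])
  qed
qed

section \<open>Standard Gaussian vectors and the chi-square law\<close>

abbreviation std_normal_vec :: "nat \<Rightarrow> (nat \<Rightarrow> real) measure" where
  "std_normal_vec s \<equiv> Pi\<^sub>M {..<s} (\<lambda>_. std_normal_distribution)"

interpretation std_normal: prob_space std_normal_distribution
  using real_dist_normal_dist by (simp add: real_distribution_def)

interpretation std_normal_prod: product_sigma_finite "\<lambda>_::nat. std_normal_distribution"
  by (simp add: product_sigma_finite_def std_normal.sigma_finite_measure_axioms)

lemma prob_space_std_normal_vec: "prob_space (std_normal_vec s)"
  by (rule prob_space_PiM) (rule std_normal.prob_space_axioms)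

lemma std_normal_component_measurable:
  "i < s \<Longrightarrow> (\<lambda>g. g i) \<in> borel_measurable (std_normal_vec s)"
  using measurable_component_singleton[of i "{..<s}" "\<lambda>_. std_normal_distribution"] by simp

lemma chi_square_measurable [measurable]:
  "(\<lambda>g. \<Sum>i<s. (g i)\<^sup>2) \<in> borel_measurable (std_normal_vec s)"
  by (intro borel_measurable_sum borel_measurable_power std_normal_component_measurable) simp

lemma real_distribution_chi_square: "real_distribution (chi_square s)"
  unfolding chi_square_def by (intro prob_space.real_distribution_distr prob_space_std_normal_vec) simp

text \<open>The Gaussian vector \<open>g\<close> is the integration variable and \<open>z\<close> is
  free, because the averaging argument for the Laplace transform takes \<open>g\<close> as frequency
  and \<open>z\<close> as data.\<close>

lemma char_std_normal_vec:
  "(CLINT g|std_normal_vec s. iexp (\<Sum>j<s. g j * z j)) = exp (- (\<Sum>j<s. (z j)\<^sup>2) / 2)"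
proof -
  have "(CLINT g|std_normal_vec s. iexp (\<Sum>j<s. g j * z j)) = (CLINT g|std_normal_vec s. (\<Prod>j<s. iexp (z j * g j)))"
    by (simp add: exp_sum[symmetric] sum_distrib_left mult.commute)
  also have "\<dots> = (\<Prod>j<s. CLINT x|std_normal_distribution. iexp (z j * x))"
    by (rule std_normal_prod.product_integral_prod) (auto intro!: std_normal.integrable_iexp)
  also have "\<dots> = (\<Prod>j<s. complex_of_real (exp (- (z j)\<^sup>2 / 2)))"
    using char_std_normal_distribution by (simp add: char_def fun_eq_iff)
  also have "\<dots> = exp (- (\<Sum>j<s. (z j)\<^sup>2) / 2)"
    by (simp add: exp_sum[symmetric] sum_negf sum_divide_distrib flip: of_real_prod)
  finally show ?thesis .
qed

text \<open>Averaging characteristic functions over a Gaussian frequency turns them into the Laplace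
  transform of the squared norm, so no multivariate continuity theorem is needed.\<close>
lemma (in prob_space) weak_conv_chi_square:
  fixes Z :: "nat \<Rightarrow> nat \<Rightarrow> 'a \<Rightarrow> real"
  assumes Z [measurable]: "\<And>n j. Z n j \<in> borel_measurable M"
    and char: "\<And>g. (\<lambda>n. CLINT \<omega>|M. iexp (\<Sum>j<s. g j * Z n j \<omega>)) \<longlonglongrightarrow> exp (- (\<Sum>j<s. (g j)\<^sup>2) / 2)"
  shows "weak_conv_m (\<lambda>n. distr M borel (\<lambda>\<omega>. \<Sum>j<s. (Z n j \<omega>)\<^sup>2)) (chi_square s)"
proof (rule laplace_imp_weak_conv)
  interpret G: prob_space "std_normal_vec s" by (rule prob_space_std_normal_vec)
  interpret MG: pair_prob_space M "std_normal_vec s" ..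
  show "real_distribution (distr M borel (\<lambda>\<omega>. \<Sum>j<s. (Z n j \<omega>)\<^sup>2))" for n
    by (rule real_distribution_distr) measurable
  show "real_distribution (chi_square s)" by (rule real_distribution_chi_square)
  show "AE x in distr M borel (\<lambda>\<omega>. \<Sum>j<s. (Z n j \<omega>)\<^sup>2). 0 \<le> x" for n
    by (subst AE_distr_iff) (auto intro!: AE_I2 sum_nonneg)
  show "AE x in chi_square s. 0 \<le> x" unfolding chi_square_def
    by (subst AE_distr_iff) (auto intro!: AE_I2 sum_nonneg)
  fix k :: nat
  \<comment> \<open>With \<open>r^2 = 2 k\<close> the Gaussian characteristic function at
    \<open>r z\<close> equals \<open>exp (- k |z|^2)\<close>, the integrand of the Laplace transform
    at \<open>k\<close>.\<close>
  define r where "r = sqrt (2 * real k)"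
  have r: "r\<^sup>2 = 2 * real k" by (simp add: r_def)
  have "(\<lambda>n. complex_of_real (\<integral>x. exp (- (real k * x)) \<partial>distr M borel (\<lambda>\<omega>. \<Sum>j<s. (Z n j \<omega>)\<^sup>2)))
      \<longlonglongrightarrow> complex_of_real (\<integral>x. exp (- (real k * x)) \<partial>chi_square s)"
  proof -
    define \<Phi> where "\<Phi> n \<omega> g = iexp (\<Sum>j<s. (r * g j) * Z n j \<omega>)" for n \<omega> g
    have \<Phi> [measurable]: "(\<lambda>z. \<Phi> n (fst z) (snd z)) \<in> borel_measurable (M \<Otimes>\<^sub>M std_normal_vec s)" for n
    proof -
      have [measurable]: "(\<lambda>z. snd z j) \<in> borel_measurable (M \<Otimes>\<^sub>M std_normal_vec s)" if "j < s" for j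
        using that by (intro measurable_compose[OF measurable_snd] std_normal_component_measurable)
      have "(\<lambda>z. \<Sum>j<s. (r * snd z j) * Z n j (fst z)) \<in> borel_measurable (M \<Otimes>\<^sub>M std_normal_vec s)"
        by (intro borel_measurable_sum) (simp, measurable)
      then show ?thesis unfolding \<Phi>_def by measurable
    qed
    have int: "integrable (M \<Otimes>\<^sub>M std_normal_vec s) (case_prod (\<Phi> n))" for n
      unfolding case_prod_unfold by (rule MG.P.integrable_const_bound[of _ 1]) (auto simp: \<Phi>_def)
    have L: "complex_of_real (\<integral>x. exp (- (real k * x)) \<partial>distr M borel (\<lambda>\<omega>. \<Sum>j<s. (Z n j \<omega>)\<^sup>2))
       = (CLINT g|std_normal_vec s. (CLINT \<omega>|M. \<Phi> n \<omega> g))" for n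
    proof -
      have "(CLINT g|std_normal_vec s. \<Phi> n \<omega> g) = complex_of_real (exp (- (real k * (\<Sum>j<s. (Z n j \<omega>)\<^sup>2))))" for \<omega>
      proof -
        have "\<Phi> n \<omega> g = iexp (\<Sum>j<s. g j * (r * Z n j \<omega>))" for g
          by (simp add: \<Phi>_def mult_ac)
        then show ?thesis
          using char_std_normal_vec[of s "\<lambda>j. r * Z n j \<omega>"]
          by (simp add: power_mult_distrib r sum_distrib_left[symmetric] exp_of_real)
      qed
      then have "complex_of_real (\<integral>x. exp (- (real k * x)) \<partial>distr M borel (\<lambda>\<omega>. \<Sum>j<s. (Z n j \<omega>)\<^sup>2))
          = (CLINT \<omega>|M. (CLINT g|std_normal_vec s. \<Phi> n \<omega> g))"
        by (simp add: integral_distr)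
      also have "\<dots> = (CLINT g|std_normal_vec s. (CLINT \<omega>|M. \<Phi> n \<omega> g))"
        using MG.Fubini_integral[OF int] by simp
      finally show ?thesis .
    qed
    \<comment> \<open>The limit needs no exchange of integrals: \<open>chi_square\<close> is by
      definition the law of the squared norm of the Gaussian frequency itself.\<close>
    have R: "complex_of_real (\<integral>x. exp (- (real k * x)) \<partial>chi_square s)
       = (CLINT g|std_normal_vec s. complex_of_real (exp (- (\<Sum>j<s. (r * g j)\<^sup>2) / 2)))"
      unfolding chi_square_def
      by (simp add: integral_distr power_mult_distrib r sum_distrib_left[symmetric])
    show ?thesis unfolding L R
    proof (rule integral_dominated_convergence[where w = "\<lambda>_. 1"])
      show "AE g in std_normal_vec s. (\<lambda>n. CLINT \<omega>|M. \<Phi> n \<omega> g) \<longlonglongrightarrow> complex_of_real (exp (- (\<Sum>j<s. (r * g j)\<^sup>2) / 2))"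
        unfolding \<Phi>_def using char by (intro AE_I2)
      show "AE g in std_normal_vec s. cmod (CLINT \<omega>|M. \<Phi> n \<omega> g) \<le> 1" for n
      proof (rule AE_I2)
        fix g
        have "cmod (CLINT \<omega>|M. \<Phi> n \<omega> g) \<le> (\<integral>\<omega>. cmod (\<Phi> n \<omega> g) \<partial>M)" by (rule integral_norm_bound)
        also have "\<dots> = 1" by (simp add: \<Phi>_def prob_space)
        finally show "cmod (CLINT \<omega>|M. \<Phi> n \<omega> g) \<le> 1" .
      qed
      show "(\<lambda>g. complex_of_real (exp (- (\<Sum>j<s. (r * g j)\<^sup>2) / 2))) \<in> borel_measurable (std_normal_vec s)"
        unfolding power_mult_distrib sum_distrib_left[symmetric] by measurable
      show "(\<lambda>g. CLINT \<omega>|M. \<Phi> n \<omega> g) \<in> borel_measurable (std_normal_vec s)" for n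
        using measurable_compose[OF measurable_pair_swap' \<Phi>[of n]]
        by (intro borel_measurable_lebesgue_integral) (simp add: case_prod_unfold)
    qed simp
  qed
  then show "(\<lambda>n. \<integral>x. exp (- (real k * x)) \<partial>distr M borel (\<lambda>\<omega>. \<Sum>j<s. (Z n j \<omega>)\<^sup>2)) \<longlonglongrightarrow> (\<integral>x. exp (- (real k * x)) \<partial>chi_square s)"
    by (simp only: tendsto_of_real_iff)
qed

text \<open>Integrate over the last coordinate first: with the others fixed, the sum of squares
  equals \<open>x\<close> for at most two of its values. For \<open>s = 0\<close> the law would be
  the point mass at 0.\<close>

lemma chi_square_atomless:
  assumes "s > 0"
  shows "measure (chi_square s) {x} = 0"
proof -
  obtain m where s: "s = Suc m" using assms gr0_conv_Suc by blast
  have ins: "{..<s} = insert m {..<m}" by (auto simp: s)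
  let ?A = "{g \<in> space (std_normal_vec s). (\<Sum>i<s. (g i)\<^sup>2) = x}"
  have A: "?A \<in> sets (std_normal_vec s)" by measurable
  have "emeasure (std_normal_vec s) ?A = (\<integral>\<^sup>+g. indicator ?A g \<partial>std_normal_vec s)" using A by simp
  also have "\<dots> = (\<integral>\<^sup>+g. (\<integral>\<^sup>+y. indicator ?A (g(m := y)) \<partial>std_normal_distribution) \<partial>std_normal_vec m)"
    unfolding ins by (rule std_normal_prod.product_nn_integral_insert) (use A ins in \<open>auto simp del: lessThan_Suc\<close>)
  also have "\<dots> \<le> (\<integral>\<^sup>+g. 0 \<partial>std_normal_vec m)"
  proof (rule nn_integral_mono)
    fix g :: "nat \<Rightarrow> real"
    define c where "c = x - (\<Sum>i<m. (g i)\<^sup>2)"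
    have "(\<integral>\<^sup>+y. indicator ?A (g(m := y)) \<partial>std_normal_distribution) \<le> (\<integral>\<^sup>+y. indicator {sqrt c, - sqrt c} y \<partial>std_normal_distribution)"
    proof (intro nn_integral_mono)
      fix y :: real
      have "y \<in> {sqrt c, - sqrt c}" if "g(m := y) \<in> ?A"
      proof -
        have "y\<^sup>2 = c" using that by (simp add: s c_def)
        then have "\<bar>y\<bar> = sqrt c" by (metis real_sqrt_abs)
        then show ?thesis by auto
      qed
      then show "indicator ?A (g(m := y)) \<le> (indicator {sqrt c, - sqrt c} y :: ennreal)"
        by (auto split: split_indicator)
    qed
    also have "\<dots> = emeasure std_normal_distribution {sqrt c, - sqrt c}" by simp
    also have "\<dots> = 0"
    proof -
      have "{sqrt c, - sqrt c} \<in> null_sets lborel" by (rule finite_imp_null_set_lborel) simp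
      then have "{sqrt c, - sqrt c} \<in> null_sets std_normal_distribution"
        using absolutely_continuousI_density[of "\<lambda>x. ennreal (std_normal_density x)" lborel]
        by (auto simp: absolutely_continuous_def)
      then show ?thesis by (rule null_setsD1)
    qed
    finally show "(\<integral>\<^sup>+y. indicator ?A (g(m := y)) \<partial>std_normal_distribution) \<le> 0" .
  qed
  finally have "emeasure (std_normal_vec s) ?A = 0" by simp
  moreover have "measure (chi_square s) {x} = measure (std_normal_vec s) ?A"
    unfolding chi_square_def by (subst measure_distr) (auto intro!: arg_cong[where f="measure (std_normal_vec s)"])
  ultimately show ?thesis by (simp add: measure_def)
qed

lemma isCont_cdf_chi_square: "s > 0 \<Longrightarrow> isCont (cdf (chi_square s)) x"
  using finite_borel_measure.isCont_cdf[of "chi_square s" x] real_distribution_chi_square[of s]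
  by (simp add: chi_square_atomless real_distribution.finite_borel_measure_M)

text \<open>The limits of the cdf at both infinities make the infimum genuine. Points just above
  \<open>q\<close> have cdf at least \<open>p\<close>, points just below have cdf less than
  \<open>p\<close>, and continuity forces equality at \<open>q\<close>.\<close>

lemma (in real_distribution) cdf_quantile:
  assumes cont: "\<And>x. isCont (cdf M) x" and p: "0 < p" "p < 1"
  shows "cdf M (quantile M p) = p"
proof -
  define S where "S = {x. p \<le> cdf M x}"
  define q where "q = quantile M p"
  have q: "q = Inf S" by (simp add: q_def quantile_def S_def)
  have "eventually (\<lambda>x. cdf M x > p) at_top" using cdf_lim_at_top_prob p(2) by (rule order_tendstoD)
  then have "S \<noteq> {}" unfolding S_def by (auto simp: eventually_at_top_linorder intro: less_imp_le)
  have "eventually (\<lambda>x. cdf M x < p) at_bot" using cdf_lim_at_bot p(1) by (rule order_tendstoD)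
  then obtain l where l: "\<And>x. x \<le> l \<Longrightarrow> cdf M x < p" by (auto simp: eventually_at_bot_linorder)
  have "bdd_below S"
  proof (rule bdd_belowI[of _ l])
    fix x assume "x \<in> S"
    then show "l \<le> x" using l[of x] by (cases "x \<le> l") (auto simp: S_def)
  qed
  have lim: "(\<lambda>n. cdf M (q + e / real (Suc n))) \<longlonglongrightarrow> cdf M q" for e
  proof (rule isCont_tendsto_compose[OF cont])
    show "(\<lambda>n. q + e / real (Suc n)) \<longlonglongrightarrow> q"
      using tendsto_add[OF tendsto_const[of q] LIMSEQ_Suc[OF lim_const_over_n[of e]]] by simp
  qed
  have "p \<le> cdf M (q + 1 / real (Suc n))" for n
  proof -
    obtain x where "x \<in> S" "x < q + 1 / real (Suc n)"
      using cInf_lessD[OF \<open>S \<noteq> {}\<close>, of "q + 1 / real (Suc n)"] q by auto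
    then show ?thesis unfolding S_def using cdf_nondecreasing[of x "q + 1 / real (Suc n)"] by auto
  qed
  then have "p \<le> cdf M q" using lim[of 1] by (intro LIMSEQ_le_const) auto
  moreover have "cdf M (q + (-1) / real (Suc n)) \<le> p" for n
  proof -
    have "q + (-1) / real (Suc n) \<notin> S"
      using cInf_lower[OF _ \<open>bdd_below S\<close>, of "q + (-1) / real (Suc n)"] q by auto
    then show ?thesis by (simp add: S_def)
  qed
  then have "cdf M q \<le> p" using lim[of "-1"] by (intro LIMSEQ_le_const2) auto
  ultimately show ?thesis by (simp add: q_def)
qed

section \<open>Second moments and the weighted triangular array\<close>

lemma outer_nth: "outer v w $ i = v $ i *\<^sub>R w"
  by (simp add: outer_def vec_eq_iff)

lemma norm_outer: "norm (outer v w) = norm v * norm w"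
proof -
  have "norm (outer v w) = L2_set (\<lambda>i. norm (v $ i) * norm w) UNIV"
    by (simp add: norm_vec_def[of "outer v w"] outer_nth)
  then show ?thesis by (simp add: L2_set_left_distrib norm_vec_def[of v])
qed

lemma outer_measurable [measurable]: "(\<lambda>v. outer v v) \<in> borel_measurable borel"
  unfolding outer_def
  by (intro borel_measurable_continuous_onI continuous_on_vec_lambda continuous_intros)

text \<open>The form is linear in the matrix, so it commutes with the Bochner integral; this reduces
  matrix moments to scalar ones.\<close>

lemma bounded_linear_quad_form:
  fixes u :: "real^'s"
  shows "bounded_linear (\<lambda>A::real^'s^'s. u \<bullet> (A *v u))"
  by (intro linear_conv_bounded_linear[THEN iffD1] linearI)
     (simp_all add: matrix_vector_mult_add_rdistrib inner_add_right scaleR_matrix_vector_assoc[symmetric])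

lemma quad_form_outer: "u \<bullet> (outer v v *v u) = (u \<bullet> v)\<^sup>2"
proof -
  have "outer v v *v u = (v \<bullet> u) *\<^sub>R v"
    by (simp add: outer_def vec_eq_iff matrix_vector_mult_def inner_vec_def sum_distrib_left mult_ac)
  then show ?thesis by (simp add: power2_eq_square inner_commute)
qed

lemma transpose_outer: "transpose (outer v v) = outer v v"
  by (simp add: transpose_def outer_def vec_eq_iff mult.commute)

lemma integrable_outer:
  fixes Z :: "'a \<Rightarrow> real^'s"
  assumes [measurable]: "Z \<in> borel_measurable M" and sq: "integrable M (\<lambda>\<omega>. (norm (Z \<omega>))\<^sup>2)"
  shows "integrable M (\<lambda>\<omega>. outer (Z \<omega>) (Z \<omega>))"
  by (rule Bochner_Integration.integrable_bound[OF sq])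
     (measurable, simp add: norm_outer power2_eq_square)

lemma quad_form_integral_outer:
  fixes Z :: "'a \<Rightarrow> real^'s"
  assumes "Z \<in> borel_measurable M" and "integrable M (\<lambda>\<omega>. (norm (Z \<omega>))\<^sup>2)"
  shows "u \<bullet> ((\<integral>\<omega>. outer (Z \<omega>) (Z \<omega>) \<partial>M) *v u) = (\<integral>\<omega>. (u \<bullet> Z \<omega>)\<^sup>2 \<partial>M)"
  using integral_bounded_linear[OF bounded_linear_quad_form[of u] integrable_outer[OF assms]]
  by (simp add: quad_form_outer)

lemma transpose_integral_outer:
  fixes Z :: "'a \<Rightarrow> real^'s"
  assumes "Z \<in> borel_measurable M" and "integrable M (\<lambda>\<omega>. (norm (Z \<omega>))\<^sup>2)"
  shows "transpose (\<integral>\<omega>. outer (Z \<omega>) (Z \<omega>) \<partial>M) = (\<integral>\<omega>. outer (Z \<omega>) (Z \<omega>) \<partial>M)"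
proof -
  have "bounded_linear (transpose :: real^'s^'s \<Rightarrow> real^'s^'s)"
    by (intro linear_conv_bounded_linear[THEN iffD1] linearI) (simp_all add: transpose_def vec_eq_iff)
  from integral_bounded_linear[OF this integrable_outer[OF assms]]
  show ?thesis by (simp add: transpose_outer)
qed

lemma integral_outer_nth:
  fixes Z :: "'a \<Rightarrow> real^'s"
  assumes "Z \<in> borel_measurable M" and "integrable M (\<lambda>\<omega>. (norm (Z \<omega>))\<^sup>2)"
  shows "(\<integral>\<omega>. outer (Z \<omega>) (Z \<omega>) \<partial>M) $ i $ j = (\<integral>\<omega>. Z \<omega> $ i * Z \<omega> $ j \<partial>M)"
proof -
  have "bounded_linear (\<lambda>A::real^'s^'s. A $ i $ j)"
    by (intro linear_conv_bounded_linear[THEN iffD1] linearI) simp_all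
  from integral_bounded_linear[OF this integrable_outer[OF assms]]
  show ?thesis by (simp add: outer_def)
qed

text \<open>Coordinate \<open>j\<close> of the path shifted by \<open>i - j\<close> is
  \<open>Y i\<close>, and that of the unshifted path is \<open>Y j\<close>; the two path laws
  agree.\<close>

lemma stationary_seq_distr:
  fixes Y :: "int \<Rightarrow> 'a \<Rightarrow> 'b::topological_space"
  assumes [measurable]: "\<And>i. Y i \<in> borel_measurable M" and st: "stationary_seq M Y"
  shows "distr M borel (Y i) = distr M borel (Y j)"
proof -
  let ?P = "Pi\<^sub>M UNIV (\<lambda>_::int. borel :: 'b measure)"
  have shift [measurable]: "(\<lambda>\<omega> i. Y (i + k) \<omega>) \<in> measurable M ?P" for k
    by (rule measurable_PiM_single') (auto simp: space_PiM)
  have "distr M borel (Y (j + k)) = distr (distr M ?P (\<lambda>\<omega> i. Y (i + k) \<omega>)) borel (\<lambda>y. y j)" for k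
    by (subst distr_distr) (auto simp: comp_def)
  from this[of "i - j"] this[of 0] show ?thesis using st by (simp add: stationary_seq_def)
qed

text \<open>Finite blocks of functions of the two sequences generate smaller sigma-algebras than the
  whole sequences, and independence passes to sub-sigma-algebras.\<close>

lemma (in prob_space) indep_seqs_imp_indep_var:
  fixes X :: "nat \<Rightarrow> 'a \<Rightarrow> real" and Y :: "int \<Rightarrow> 'a \<Rightarrow> 'c::topological_space"
  assumes ind: "indep_seqs M X Y"
    and X [measurable]: "\<And>i. i \<ge> 1 \<Longrightarrow> X i \<in> borel_measurable M" and Y [measurable]: "\<And>i. Y i \<in> borel_measurable M"
    and \<phi> [measurable]: "\<phi> \<in> borel_measurable borel" and \<psi> [measurable]: "\<psi> \<in> borel_measurable borel"
  shows "indep_var (PiM {1..n} (\<lambda>_. borel :: real measure)) (\<lambda>\<omega>. \<lambda>i\<in>{1..n}. \<phi> (X i \<omega>))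
           (PiM {1..n} (\<lambda>_. borel :: real measure)) (\<lambda>\<omega>. \<lambda>i\<in>{1..n}. \<psi> (Y (int i) \<omega>))"
proof -
  let ?P = "PiM {1..n} (\<lambda>_. borel :: real measure)"
  let ?PX = "Pi\<^sub>M {1::nat..} (\<lambda>_. borel :: real measure)" and ?PY = "Pi\<^sub>M UNIV (\<lambda>_::int. borel :: 'c measure)"
  let ?VX = "vimage_algebra (space M) (\<lambda>\<omega>. \<lambda>i\<in>{1..}. X i \<omega>) ?PX"
  let ?VY = "vimage_algebra (space M) (\<lambda>\<omega> i. Y i \<omega>) ?PY"
  let ?X = "\<lambda>\<omega>. \<lambda>i\<in>{1..n}. \<phi> (X i \<omega>)" and ?Y = "\<lambda>\<omega>. \<lambda>i\<in>{1..n}. \<psi> (Y (int i) \<omega>)"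
  have fX: "(\<lambda>x. \<lambda>i\<in>{1..n}. \<phi> (x i)) \<in> measurable ?PX ?P"
    by (intro measurable_restrict measurable_compose[OF _ \<phi>] measurable_component_singleton) auto
  have "(\<lambda>\<omega>. (\<lambda>x. \<lambda>i\<in>{1..n}. \<phi> (x i)) (\<lambda>i\<in>{1..}. X i \<omega>)) \<in> measurable ?VX ?P"
    by (rule measurable_compose[OF measurable_vimage_algebra1 fX]) (simp add: space_PiM PiE_iff extensional_def)
  also have "(\<lambda>\<omega>. (\<lambda>x. \<lambda>i\<in>{1..n}. \<phi> (x i)) (\<lambda>i\<in>{1..}. X i \<omega>)) = ?X" by (auto simp: fun_eq_iff)
  finally have mX: "?X \<in> measurable ?VX ?P" .
  have fY: "(\<lambda>y. \<lambda>i\<in>{1..n}. \<psi> (y (int i))) \<in> measurable ?PY ?P"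
    by (intro measurable_restrict measurable_compose[OF _ \<psi>] measurable_component_singleton) auto
  have mY: "?Y \<in> measurable ?VY ?P"
    by (rule measurable_compose[OF measurable_vimage_algebra1 fY]) (simp add: space_PiM)
  have sX: "sigma_sets (space M) {?X -` A \<inter> space M | A. A \<in> sets ?P} \<subseteq> sets ?VX"
    using measurable_sets[OF mX] sets.sigma_sets_subset[of _ ?VX] by (auto intro!: sets.sigma_sets_subset[of _ ?VX, simplified])
  have sY: "sigma_sets (space M) {?Y -` A \<inter> space M | A. A \<in> sets ?P} \<subseteq> sets ?VY"
    using measurable_sets[OF mY] by (auto intro!: sets.sigma_sets_subset[of _ ?VY, simplified])
  show ?thesis
    unfolding indep_var_eq
  proof safe
    show "?X \<in> measurable M ?P" by (intro measurable_restrict) auto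
    show "?Y \<in> measurable M ?P" by (intro measurable_restrict) auto
    show "indep_set (sigma_sets (space M) {?X -` A \<inter> space M | A. A \<in> sets ?P})
       (sigma_sets (space M) {?Y -` A \<inter> space M | A. A \<in> sets ?P})"
      using ind sX sY unfolding indep_seqs_def indep_set_def
      by (elim indep_sets_mono_sets) (auto split: bool.split)
  qed
qed

text \<open>Equal laws of the weights collapse the Lindeberg error to \<open>n * v n\<close> times
  one expectation, which vanishes by dominated convergence. The Gaussian side is a function of
  \<open>n * v n\<close> and of the average of the squared weights; the latter has a constant limit,
  so the limit is a genuine and not a mixed Gaussian.\<close>

lemma (in prob_space) weighted_triangular_clt:
  fixes \<xi> :: "nat \<Rightarrow> nat \<Rightarrow> 'a \<Rightarrow> real" and a :: "nat \<Rightarrow> 'a \<Rightarrow> real"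
  assumes ind: "\<And>n. n \<ge> 1 \<Longrightarrow> indep_vars (\<lambda>_. borel) (\<xi> n) {1..n}"
    and ind2: "\<And>n. n \<ge> 1 \<Longrightarrow> indep_var (PiM {1..n} (\<lambda>_. borel)) (\<lambda>\<omega>. \<lambda>i\<in>{1..n}. \<xi> n i \<omega>) (PiM {1..n} (\<lambda>_. borel)) (\<lambda>\<omega>. \<lambda>i\<in>{1..n}. a i \<omega>)"
    and bound: "\<And>n i \<omega>. n \<ge> 1 \<Longrightarrow> \<bar>\<xi> n i \<omega>\<bar> \<le> e n"
    and mean: "\<And>n i. n \<ge> 1 \<Longrightarrow> i \<in> {1..n} \<Longrightarrow> expectation (\<xi> n i) = 0"
    and var: "\<And>n i. n \<ge> 1 \<Longrightarrow> i \<in> {1..n} \<Longrightarrow> expectation (\<lambda>\<omega>. (\<xi> n i \<omega>)\<^sup>2) = v n"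
    and a [measurable]: "\<And>i. a i \<in> borel_measurable M" and a_distr: "\<And>i. distr M borel (a i) = distr M borel (a 1)"
    and sq: "integrable M (\<lambda>\<omega>. (a 1 \<omega>)\<^sup>2)"
    and lln: "AE \<omega> in M. (\<lambda>n. (\<Sum>i=1..n. (a i \<omega>)\<^sup>2) / n) \<longlonglongrightarrow> A"
    and e_lim: "e \<longlonglongrightarrow> 0" and v_lim: "(\<lambda>n. real n * v n) \<longlonglongrightarrow> c"
  shows "(\<lambda>n. CLINT \<omega>|M. iexp (\<Sum>i=1..n. a i \<omega> * \<xi> n i \<omega>)) \<longlonglongrightarrow> exp (- (c * A / 2))"
proof -
  define E where "E n = complex_of_real (\<integral>\<omega>. exp (- (v n / 2 * (\<Sum>i=1..n. (a i \<omega>)\<^sup>2))) \<partial>M)" for n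
  have transfer: "expectation (\<lambda>\<omega>. g (a i \<omega>)) = expectation (\<lambda>\<omega>. g (a 1 \<omega>))"
    and transfer_int: "integrable M (\<lambda>\<omega>. g (a i \<omega>)) \<longleftrightarrow> integrable M (\<lambda>\<omega>. g (a 1 \<omega>))"
    if [measurable]: "g \<in> borel_measurable borel" for g :: "real \<Rightarrow> real" and i
    using integral_distr[of "a i" M borel g] integral_distr[of "a 1" M borel g]
      integrable_distr_eq[of "a i" M borel g] integrable_distr_eq[of "a 1" M borel g] a_distr[of i] by simp_all
  have sq': "integrable M (\<lambda>\<omega>. (a i \<omega>)\<^sup>2)" for i using transfer_int[of "\<lambda>x. x\<^sup>2" i] sq by simp
  have e0: "e n \<ge> 0" if "n \<ge> 1" for n using bound[OF that, of undefined undefined] by linarith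
  have v0: "v n \<ge> 0" if "n \<ge> 1" for n using var[OF that, of 1] that by (metis Bochner_Integration.integral_nonneg atLeastAtMost_iff le_refl zero_le_power2)
  \<comment> \<open>The absolute value of \<open>e n\<close> matters at \<open>n = 0\<close> only,
    where the sign of \<open>e n\<close> is unknown; it makes the domination valid for every
    index.\<close>
  have "(\<lambda>n. expectation (\<lambda>\<omega>. (a 1 \<omega>)\<^sup>2 * min 1 (\<bar>a 1 \<omega>\<bar> * \<bar>e n\<bar>))) \<longlonglongrightarrow> expectation (\<lambda>\<omega>. 0)"
  proof (rule integral_dominated_convergence[where w = "\<lambda>\<omega>. (a 1 \<omega>)\<^sup>2"])
    show "AE \<omega> in M. (\<lambda>n. (a 1 \<omega>)\<^sup>2 * min 1 (\<bar>a 1 \<omega>\<bar> * \<bar>e n\<bar>)) \<longlonglongrightarrow> 0"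
    proof (rule AE_I2)
      fix \<omega>
      have "(\<lambda>n. (a 1 \<omega>)\<^sup>2 * min 1 (\<bar>a 1 \<omega>\<bar> * \<bar>e n\<bar>)) \<longlonglongrightarrow> (a 1 \<omega>)\<^sup>2 * min 1 (\<bar>a 1 \<omega>\<bar> * \<bar>0\<bar>)"
        by (intro tendsto_intros e_lim)
      then show "(\<lambda>n. (a 1 \<omega>)\<^sup>2 * min 1 (\<bar>a 1 \<omega>\<bar> * \<bar>e n\<bar>)) \<longlonglongrightarrow> 0" by simp
    qed
    show "AE \<omega> in M. norm ((a 1 \<omega>)\<^sup>2 * min 1 (\<bar>a 1 \<omega>\<bar> * \<bar>e n\<bar>)) \<le> (a 1 \<omega>)\<^sup>2" for n
      by (intro AE_I2) (simp add: abs_mult mult_left_le)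
  qed (use sq in simp_all)
  then have "(\<lambda>n. 2 * (real n * v n) * expectation (\<lambda>\<omega>. (a 1 \<omega>)\<^sup>2 * min 1 (\<bar>a 1 \<omega>\<bar> * \<bar>e n\<bar>))) \<longlonglongrightarrow> 2 * c * 0"
    by (intro tendsto_intros v_lim) simp
  then have bound_lim: "(\<lambda>n. 2 * (real n * v n) * expectation (\<lambda>\<omega>. (a 1 \<omega>)\<^sup>2 * min 1 (\<bar>a 1 \<omega>\<bar> * \<bar>e n\<bar>))) \<longlonglongrightarrow> 0"
    by simp
  have "(\<lambda>n. (CLINT \<omega>|M. iexp (\<Sum>i=1..n. a i \<omega> * \<xi> n i \<omega>)) - E n) \<longlonglongrightarrow> 0"
  proof (rule Lim_null_comparison[OF _ bound_lim])
    show "eventually (\<lambda>n. norm ((CLINT \<omega>|M. iexp (\<Sum>i=1..n. a i \<omega> * \<xi> n i \<omega>)) - E n) \<le>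
       2 * (real n * v n) * expectation (\<lambda>\<omega>. (a 1 \<omega>)\<^sup>2 * min 1 (\<bar>a 1 \<omega>\<bar> * \<bar>e n\<bar>))) sequentially"
      using eventually_ge_at_top[of 1]
    proof eventually_elim
      case (elim n)
      have "norm ((CLINT \<omega>|M. iexp (\<Sum>i=1..n. a i \<omega> * \<xi> n i \<omega>)) - E n)
        \<le> 2 * v n * (\<Sum>i=1..n. expectation (\<lambda>\<omega>. (a i \<omega>)\<^sup>2 * min 1 (\<bar>a i \<omega>\<bar> * e n)))"
        unfolding E_def integral_complex_of_real[symmetric]
        by (rule mixed_clt_bound) (use elim ind ind2 bound mean var sq' in auto)
      also have "(\<Sum>i=1..n. expectation (\<lambda>\<omega>. (a i \<omega>)\<^sup>2 * min 1 (\<bar>a i \<omega>\<bar> * e n))) =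
         (\<Sum>i=1..n. expectation (\<lambda>\<omega>. (a 1 \<omega>)\<^sup>2 * min 1 (\<bar>a 1 \<omega>\<bar> * \<bar>e n\<bar>)))"
      proof (rule sum.cong[OF refl])
        fix i
        show "expectation (\<lambda>\<omega>. (a i \<omega>)\<^sup>2 * min 1 (\<bar>a i \<omega>\<bar> * e n)) = expectation (\<lambda>\<omega>. (a 1 \<omega>)\<^sup>2 * min 1 (\<bar>a 1 \<omega>\<bar> * \<bar>e n\<bar>))"
          using transfer[of "\<lambda>x. x\<^sup>2 * min 1 (\<bar>x\<bar> * e n)" i] e0[OF elim] by simp
      qed
      finally show ?case by (simp add: mult_ac)
    qed
  qed
  moreover have "(\<lambda>n. \<integral>\<omega>. exp (- (v n / 2 * (\<Sum>i=1..n. (a i \<omega>)\<^sup>2))) \<partial>M) \<longlonglongrightarrow> (\<integral>\<omega>. exp (- (c * A / 2)) \<partial>M)"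
  \<comment> \<open>The shift to \<open>Suc n\<close> keeps to positive indices: there
    \<open>v\<close> is known to be nonnegative, and the factor \<open>n\<close> cancels against the
    average.\<close>
  proof (rule LIMSEQ_imp_Suc, rule integral_dominated_convergence[where w = "\<lambda>\<omega>. 1"])
    show "AE \<omega> in M. (\<lambda>n. exp (- (v (Suc n) / 2 * (\<Sum>i=1..Suc n. (a i \<omega>)\<^sup>2)))) \<longlonglongrightarrow> exp (- (c * A / 2))"
      using lln
    proof eventually_elim
      case (elim \<omega>)
      have "(\<lambda>n. exp (- ((real n * v n) * ((\<Sum>i=1..n. (a i \<omega>)\<^sup>2) / n) / 2))) \<longlonglongrightarrow> exp (- (c * A / 2))"
        by (intro tendsto_intros v_lim elim) simp
      then have "(\<lambda>n. exp (- ((real (Suc n) * v (Suc n)) * ((\<Sum>i=1..Suc n. (a i \<omega>)\<^sup>2) / Suc n) / 2))) \<longlonglongrightarrow> exp (- (c * A / 2))"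
        by (rule LIMSEQ_Suc)
      moreover have "(real (Suc n) * v (Suc n)) * ((\<Sum>i=1..Suc n. (a i \<omega>)\<^sup>2) / Suc n) / 2 = v (Suc n) / 2 * (\<Sum>i=1..Suc n. (a i \<omega>)\<^sup>2)" for n
        by (simp del: sum.cl_ivl_Suc of_nat_Suc)
      ultimately show ?case by (simp only:)
    qed
    show "AE \<omega> in M. norm (exp (- (v (Suc n) / 2 * (\<Sum>i=1..Suc n. (a i \<omega>)\<^sup>2)))) \<le> 1" for n
      using v0[of "Suc n"] by (intro AE_I2) (auto intro!: mult_nonneg_nonneg sum_nonneg simp del: sum.cl_ivl_Suc)
  qed simp_all
  then have "E \<longlonglongrightarrow> complex_of_real (exp (- (c * A / 2)))"
    unfolding E_def by (intro tendsto_of_real) (simp add: prob_space)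
  ultimately have "(\<lambda>n. ((CLINT \<omega>|M. iexp (\<Sum>i=1..n. a i \<omega> * \<xi> n i \<omega>)) - E n) + E n) \<longlonglongrightarrow> 0 + complex_of_real (exp (- (c * A / 2)))"
    by (rule tendsto_add)
  then show ?thesis by simp
qed

text \<open>A perturbation that is small in \<open>L^2\<close> is invisible to characteristic
  functions: \<open>iexp\<close> is 1-Lipschitz, and the mean of \<open>|b|\<close> is at most its
  \<open>L^2\<close> norm. It serves to drop the bias.\<close>

lemma (in prob_space) iexp_perturb:
  fixes S b :: "'a \<Rightarrow> real"
  assumes [measurable]: "S \<in> borel_measurable M" "b \<in> borel_measurable M" and sq: "integrable M (\<lambda>\<omega>. (b \<omega>)\<^sup>2)"
  shows "cmod ((CLINT \<omega>|M. iexp (S \<omega> + b \<omega>)) - (CLINT \<omega>|M. iexp (S \<omega>))) \<le> sqrt (expectation (\<lambda>\<omega>. (b \<omega>)\<^sup>2))"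
proof -
  have b: "integrable M b" using square_integrable_imp_integrable[OF _ sq] by simp
  have "cmod ((CLINT \<omega>|M. iexp (S \<omega> + b \<omega>)) - (CLINT \<omega>|M. iexp (S \<omega>))) = cmod (CLINT \<omega>|M. iexp (S \<omega> + b \<omega>) - iexp (S \<omega>))"
    by (subst Bochner_Integration.integral_diff) (auto intro!: integrable_iexp)
  also have "\<dots> \<le> expectation (\<lambda>\<omega>. cmod (iexp (S \<omega> + b \<omega>) - iexp (S \<omega>)))" by (rule integral_norm_bound)
  also have "\<dots> \<le> expectation (\<lambda>\<omega>. \<bar>b \<omega>\<bar>)"
  proof (rule integral_mono)
    show "integrable M (\<lambda>\<omega>. cmod (iexp (S \<omega> + b \<omega>) - iexp (S \<omega>)))"
      by (intro integrable_norm Bochner_Integration.integrable_diff integrable_iexp) auto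
    show "integrable M (\<lambda>\<omega>. \<bar>b \<omega>\<bar>)" using b by simp
    fix \<omega>
    have "iexp (S \<omega> + b \<omega>) - iexp (S \<omega>) = iexp (S \<omega>) * (iexp (b \<omega>) - 1)"
      by (simp add: exp_add ring_distribs)
    then have "cmod (iexp (S \<omega> + b \<omega>) - iexp (S \<omega>)) = cmod (iexp (b \<omega>) - 1)" by (simp add: norm_mult)
    also have "\<dots> \<le> \<bar>b \<omega>\<bar>" using iexp_approx1[of "b \<omega>" 0] by simp
    finally show "cmod (iexp (S \<omega> + b \<omega>) - iexp (S \<omega>)) \<le> \<bar>b \<omega>\<bar>" .
  qed
  also have "\<dots> \<le> sqrt (expectation (\<lambda>\<omega>. (b \<omega>)\<^sup>2))"
  proof (rule real_le_rsqrt)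
    have "0 \<le> variance (\<lambda>\<omega>. \<bar>b \<omega>\<bar>)" by (rule variance_positive)
    also have "\<dots> = expectation (\<lambda>\<omega>. (b \<omega>)\<^sup>2) - (expectation (\<lambda>\<omega>. \<bar>b \<omega>\<bar>))\<^sup>2"
      by (subst variance_eq) (use b sq in auto)
    finally show "(expectation (\<lambda>\<omega>. \<bar>b \<omega>\<bar>))\<^sup>2 \<le> expectation (\<lambda>\<omega>. (b \<omega>)\<^sup>2)" by simp
  qed
  finally show ?thesis .
qed

section \<open>Square integrability of sums\<close>

lemma norm_add_squared_le:
  fixes x y :: "'a::real_normed_vector"
  shows "(norm (x + y))\<^sup>2 \<le> 2 * (norm x)\<^sup>2 + 2 * (norm y)\<^sup>2"
proof -
  have "(norm (x + y))\<^sup>2 \<le> (norm x + norm y)\<^sup>2" by (intro power_mono norm_triangle_ineq) simp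
  also have "\<dots> \<le> 2 * (norm x)\<^sup>2 + 2 * (norm y)\<^sup>2"
    using zero_le_power2[of "norm x - norm y"] by (simp add: power2_eq_square algebra_simps)
  finally show ?thesis .
qed

lemma square_integrable_add:
  fixes U V :: "'a \<Rightarrow> 'b::{second_countable_topology, banach}"
  assumes [measurable]: "U \<in> borel_measurable M" "V \<in> borel_measurable M"
    and "integrable M (\<lambda>\<omega>. (norm (U \<omega>))\<^sup>2)" "integrable M (\<lambda>\<omega>. (norm (V \<omega>))\<^sup>2)"
  shows "integrable M (\<lambda>\<omega>. (norm (U \<omega> + V \<omega>))\<^sup>2)"
  by (rule Bochner_Integration.integrable_bound[of _ "\<lambda>\<omega>. 2 * (norm (U \<omega>))\<^sup>2 + 2 * (norm (V \<omega>))\<^sup>2"])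
     (use assms norm_add_squared_le in auto)

lemma square_integrable_sum:
  fixes U :: "'i \<Rightarrow> 'a \<Rightarrow> 'b::{second_countable_topology, banach}"
  assumes "\<And>i. i \<in> I \<Longrightarrow> U i \<in> borel_measurable M"
    and "\<And>i. i \<in> I \<Longrightarrow> integrable M (\<lambda>\<omega>. (norm (U i \<omega>))\<^sup>2)"
  shows "integrable M (\<lambda>\<omega>. (norm (\<Sum>i\<in>I. U i \<omega>))\<^sup>2)"
  using assms
  by (induction I rule: infinite_finite_induct) (simp_all add: square_integrable_add)

section \<open>Asymptotic coverage\<close>

lemma (in prob_space) tendsto_AE_imp_tendsto_prob:
  fixes Z :: "nat \<Rightarrow> 'a \<Rightarrow> 'b::{second_countable_topology, real_normed_vector}"
  assumes Z [measurable]: "\<And>n. Z n \<in> borel_measurable M" and lim: "AE \<omega> in M. (\<lambda>n. Z n \<omega>) \<longlonglongrightarrow> z" and e: "e > 0"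
  shows "(\<lambda>n. prob {\<omega> \<in> space M. e < norm (Z n \<omega> - z)}) \<longlonglongrightarrow> 0"
proof -
  let ?B = "\<lambda>n. {\<omega> \<in> space M. e < norm (Z n \<omega> - z)}"
  have "(\<lambda>n. \<integral>\<omega>. indicator (?B n) \<omega> \<partial>M) \<longlonglongrightarrow> (\<integral>\<omega>. (0::real) \<partial>M)"
  proof (rule integral_dominated_convergence[where w = "\<lambda>_. 1"])
    show "AE \<omega> in M. (\<lambda>n. indicator (?B n) \<omega> :: real) \<longlonglongrightarrow> 0"
      using lim
    proof eventually_elim
      case (elim \<omega>)
      have "eventually (\<lambda>n. dist (Z n \<omega>) z < e) sequentially" using tendstoD[OF elim e] .
      then have "eventually (\<lambda>n. 0 = (indicator (?B n) \<omega> :: real)) sequentially"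
        by eventually_elim (auto simp: dist_norm)
      then show ?case by (rule Lim_transform_eventually[rotated]) simp
    qed
  qed (auto split: split_indicator)
  then show ?thesis by simp
qed

text \<open>The ergodic theorem applied to each entry; there are finitely many index pairs, so their
  null sets combine.\<close>

lemma Sigma_hat_tendsto:
  fixes Y :: "int \<Rightarrow> 'a \<Rightarrow> real^'s"
  assumes M: "prob_space M" and rv [measurable]: "\<And>i. Y i \<in> borel_measurable M"
    and st: "stationary_seq M Y" and er: "ergodic_seq M Y"
    and sq: "integrable M (\<lambda>\<omega>. (norm (Y 1 \<omega>))\<^sup>2)"
  shows "AE \<omega> in M. (\<lambda>n. Sigma_hat Y n \<omega>) \<longlonglongrightarrow> (\<integral>\<omega>. outer (Y 1 \<omega>) (Y 1 \<omega>) \<partial>M)"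
proof -
  have "AE \<omega> in M. (\<lambda>n. (\<Sum>k=1..n. Y (int k) \<omega> $ fst p * Y (int k) \<omega> $ snd p) / n) \<longlonglongrightarrow> (\<integral>\<omega>. Y 1 \<omega> $ fst p * Y 1 \<omega> $ snd p \<partial>M)" for p :: "'s \<times> 's"
  proof (rule stationary_ergodic_averages[OF M rv st er])
    show "integrable M (\<lambda>\<omega>. Y 1 \<omega> $ fst p * Y 1 \<omega> $ snd p)"
    proof (rule Bochner_Integration.integrable_bound[OF sq])
      show "AE \<omega> in M. norm (Y 1 \<omega> $ fst p * Y 1 \<omega> $ snd p) \<le> norm ((norm (Y 1 \<omega>))\<^sup>2)"
        by (intro AE_I2) (simp add: abs_mult power2_eq_square mult_mono component_le_norm_cart)
      have [measurable]: "(\<lambda>v::real^'s. v $ i) \<in> borel_measurable borel" for i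
        by (intro borel_measurable_continuous_onI continuous_intros)
      show "(\<lambda>\<omega>. Y 1 \<omega> $ fst p * Y 1 \<omega> $ snd p) \<in> borel_measurable M" by measurable
    qed
  qed simp
  then have "AE \<omega> in M. \<forall>p\<in>(UNIV :: ('s \<times> 's) set). (\<lambda>n. (\<Sum>k=1..n. Y (int k) \<omega> $ fst p * Y (int k) \<omega> $ snd p) / n) \<longlonglongrightarrow> (\<integral>\<omega>. Y 1 \<omega> $ fst p * Y 1 \<omega> $ snd p \<partial>M)"
    by (intro AE_finite_allI) auto
  then show ?thesis
  proof eventually_elim
    case (elim \<omega>)
    show ?case
    proof (intro vec_tendstoI)
      fix i j
      show "(\<lambda>n. Sigma_hat Y n \<omega> $ i $ j) \<longlonglongrightarrow> (\<integral>\<omega>. outer (Y 1 \<omega>) (Y 1 \<omega>) \<partial>M) $ i $ j"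
        using bspec[OF elim, of "(i, j)"] integral_outer_nth[OF rv[of 1] sq, of i j]
        by (simp add: Sigma_hat_def outer_def)
    qed
  qed
qed

text \<open>Outside a small exceptional event, \<open>E n\<close> lies between two level events of
  \<open>V n\<close> whose thresholds differ from \<open>q\<close> by a relative error
  \<open>d\<close>; this is the kind of error that comparing inverse quadratic forms produces.
  Continuity of \<open>F\<close> at \<open>q\<close> then lets \<open>d\<close> shrink.\<close>

lemma (in prob_space) tendsto_prob_sandwich:
  fixes V :: "nat \<Rightarrow> 'a \<Rightarrow> real" and F :: "real \<Rightarrow> real"
  assumes V [measurable]: "\<And>n. V n \<in> borel_measurable M"
    and lim: "\<And>x. (\<lambda>n. prob {\<omega> \<in> space M. V n \<omega> \<le> x}) \<longlonglongrightarrow> F x"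
    and cont: "isCont F q" and q: "q \<ge> 0"
    and E: "eventually (\<lambda>n. E n \<in> events) sequentially"
    and sandwich: "\<And>d. 0 < d \<Longrightarrow> d < 1 \<Longrightarrow> \<exists>B. (\<forall>n. B n \<in> events) \<and> (\<lambda>n. prob (B n)) \<longlonglongrightarrow> 0 \<and>
       eventually (\<lambda>n. \<forall>\<omega>\<in>space M - B n. (\<omega> \<in> E n \<longrightarrow> V n \<omega> \<le> (1 + d) * q) \<and> (V n \<omega> \<le> (1 - d) * q \<longrightarrow> \<omega> \<in> E n)) sequentially"
  shows "(\<lambda>n. prob (E n)) \<longlonglongrightarrow> F q"
proof (rule tendstoI)
  fix e :: real assume e: "e > 0"
  obtain r where r: "r > 0" "\<And>x. \<bar>x - q\<bar> < r \<Longrightarrow> \<bar>F x - F q\<bar> < e / 3"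
    using cont[unfolded continuous_at_eps_delta, rule_format, of "e / 3"] e by (auto simp: dist_real_def)
  \<comment> \<open>The denominator \<open>q + 1\<close> gives \<open>d * q < r\<close> and also
    covers \<open>q = 0\<close>; the bound \<open>1/2\<close> keeps \<open>d < 1\<close>.\<close>
  define d where "d = min (1/2) (r / (q + 1) / 2)"
  have d: "0 < d" "d < 1" using r q unfolding d_def by (simp_all add: min_less_iff_disj)
  have "d * q < r"
  proof -
    have "d * q \<le> r / (q + 1) / 2 * (q + 1)" using q r d by (intro mult_mono) (auto simp: d_def)
    also have "\<dots> < r" using q r by (simp add: field_simps add_pos_nonneg)
    finally show ?thesis .
  qed
  moreover have "(1 + d) * q - q = d * q" "(1 - d) * q - q = - (d * q)" "0 \<le> d * q"
    using d q by (simp_all add: algebra_simps)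
  ultimately have "\<bar>(1 + d) * q - q\<bar> < r" "\<bar>(1 - d) * q - q\<bar> < r" by simp_all
  then have F: "\<bar>F ((1 + d) * q) - F q\<bar> < e / 3" "\<bar>F ((1 - d) * q) - F q\<bar> < e / 3"
    by (blast intro: r(2))+
  obtain B where B: "\<And>n. B n \<in> events" "(\<lambda>n. prob (B n)) \<longlonglongrightarrow> 0"
    and sw: "eventually (\<lambda>n. \<forall>\<omega>\<in>space M - B n. (\<omega> \<in> E n \<longrightarrow> V n \<omega> \<le> (1 + d) * q) \<and> (V n \<omega> \<le> (1 - d) * q \<longrightarrow> \<omega> \<in> E n)) sequentially"
    using sandwich[OF d] by blast
  have "eventually (\<lambda>n. prob (B n) < e / 3) sequentially" by (rule order_tendstoD(2)[OF B(2)]) (use e in simp)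
  moreover have "eventually (\<lambda>n. dist (prob {\<omega> \<in> space M. V n \<omega> \<le> (1 + d) * q}) (F ((1 + d) * q)) < e / 3) sequentially"
    by (rule tendstoD[OF lim]) (use e in simp)
  moreover have "eventually (\<lambda>n. dist (prob {\<omega> \<in> space M. V n \<omega> \<le> (1 - d) * q}) (F ((1 - d) * q)) < e / 3) sequentially"
    by (rule tendstoD[OF lim]) (use e in simp)
  ultimately show "eventually (\<lambda>n. dist (prob (E n)) (F q) < e) sequentially"
    using sw E
  proof eventually_elim
    case (elim n)
    note [measurable] = B(1)[of n] \<open>E n \<in> events\<close>
    have "prob (E n) \<le> prob ({\<omega> \<in> space M. V n \<omega> \<le> (1 + d) * q} \<union> B n)"
      by (rule finite_measure_mono) (use elim sets.sets_into_space[OF \<open>E n \<in> events\<close>] in auto)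
    also have "\<dots> \<le> prob {\<omega> \<in> space M. V n \<omega> \<le> (1 + d) * q} + prob (B n)"
      by (rule measure_Un_le) measurable
    finally have up: "prob (E n) \<le> prob {\<omega> \<in> space M. V n \<omega> \<le> (1 + d) * q} + prob (B n)" .
    have "prob {\<omega> \<in> space M. V n \<omega> \<le> (1 - d) * q} \<le> prob (E n \<union> B n)"
      by (rule finite_measure_mono) (use elim in auto)
    also have "\<dots> \<le> prob (E n) + prob (B n)" by (rule measure_Un_le) measurable
    finally show ?case using up elim(1-3) F unfolding dist_real_def by linarith
  qed
qed

text \<open>The variance in direction \<open>u\<close> is the quadratic form of the covariance
  matrix at \<open>u\<close>. In this way the assumption on \<open>lambda_max\<close> controls the
  bias.\<close>

lemma (in prob_space) variance_inner_le_lambda_max: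
  fixes Z :: "'a \<Rightarrow> real^'s"
  assumes [measurable]: "Z \<in> borel_measurable M" and sq: "integrable M (\<lambda>\<omega>. (norm (Z \<omega>))\<^sup>2)"
  shows "expectation (\<lambda>\<omega>. (u \<bullet> (Z \<omega> - expectation Z))\<^sup>2) \<le> lambda_max (cov_matrix M Z) * (u \<bullet> u)"
proof -
  let ?Z = "\<lambda>\<omega>. Z \<omega> - expectation Z"
  have sq': "integrable M (\<lambda>\<omega>. (norm (?Z \<omega>))\<^sup>2)"
    using square_integrable_add[of Z M "\<lambda>_. - expectation Z"] sq by simp
  have "expectation (\<lambda>\<omega>. (u \<bullet> ?Z \<omega>)\<^sup>2) = u \<bullet> (cov_matrix M Z *v u)"
    unfolding cov_matrix_def by (subst quad_form_integral_outer[OF _ sq']) simp_all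
  also have "\<dots> \<le> lambda_max (cov_matrix M Z) * (u \<bullet> u)"
    by (rule le_lambda_max) (simp add: cov_matrix_def transpose_integral_outer[OF _ sq'])
  finally show ?thesis .
qed

lemma (in prob_space) expectation_kernel:
  fixes f G :: "real \<Rightarrow> real"
  assumes X: "distributed M lborel X (\<lambda>x. ennreal (f x))" and f: "\<And>x. 0 \<le> f x"
    and [measurable]: "G \<in> borel_measurable borel"
  shows "expectation (\<lambda>\<omega>. G (X \<omega> / c)) = (\<integral>x. f x * G (x / c) \<partial>lborel)"
  using distributed_integral[OF X, of "\<lambda>x. G (x / c)"] f by simp

theorem corollary2p1:
  fixes M :: "'a measure"
    and Y :: "int \<Rightarrow> 'a \<Rightarrow> real^'s"
    and X :: "nat \<Rightarrow> 'a \<Rightarrow> real"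
    and f K :: "real \<Rightarrow> real"
    and h :: "nat \<Rightarrow> real"
    and \<mu> :: "real^'s"
    and \<alpha> :: real
    and C :: "nat \<Rightarrow> 'a \<Rightarrow> (real^'s) set"
  assumes "prob_space M"
    and Y_rv: "\<And>i. Y i \<in> borel_measurable M"
    and Y_stationary: "stationary_seq M Y"
    and Y_ergodic: "ergodic_seq M Y"
    and Y_square_integrable: "integrable M (\<lambda>\<omega>. (norm (Y 1 \<omega>))\<^sup>2)"
    and mean: "\<mu> = (\<integral>\<omega>. Y 1 \<omega> \<partial>M)"
    and Y_pos_definite: "pos_definite (\<integral>\<omega>. outer (Y 1 \<omega>) (Y 1 \<omega>) \<partial>M)"
    and X_indep: "prob_space.indep_vars M (\<lambda>_. borel) X {1..}"
    and X_density: "\<And>i. i \<ge> 1 \<Longrightarrow> distributed M lborel (X i) (\<lambda>x. ennreal (f x))"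
    and X_Y_indep: "indep_seqs M X Y"
    and f_nonneg: "\<And>x. 0 \<le> f x"
    and f_bounded: "bounded (range f)"
    and f_cont: "isCont f 0"
    and f_pos: "0 < f 0"
    and K_nonneg: "\<And>u. 0 \<le> K u"
    and K_symmetric: "\<And>u. K (- u) = K u"
    and K_bounded: "bounded (range K)"
    and K_integrable: "integrable lborel K"
    and K_integral: "(\<integral>u. K u \<partial>lborel) = 1"
    and K_square_integrable: "integrable lborel (\<lambda>u. (K u)\<^sup>2)"
    and h_pos: "\<And>n. n \<ge> 1 \<Longrightarrow> 0 < h n"
    and h_lim: "h \<longlonglongrightarrow> 0"
    and nh_lim: "filterlim (\<lambda>n. real n * h n) at_top sequentially"
    and cov_lim: "(\<lambda>n. real n * h n *
          lambda_max (cov_matrix M (\<lambda>\<omega>. (1 / real n) *\<^sub>R (\<Sum>i=1..n. Y (int i) \<omega>)))) \<longlonglongrightarrow> 0"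
    and alpha: "0 < \<alpha>" "\<alpha> < 1"
    \<comment> \<open>the region is arbitrary where \<open>Sigma_hat\<close> is singular, as long as coverage is an event\<close>
    and C_region: "\<And>n \<omega>. n \<ge> 1 \<Longrightarrow> \<omega> \<in> space M \<Longrightarrow> invertible (Sigma_hat Y n \<omega>) \<Longrightarrow>
          C n \<omega> = {x. real n * h n *
              ((r_hat M K h X Y n \<omega> - x) \<bullet> (matrix_inv (Sigma_hat Y n \<omega>) *v (r_hat M K h X Y n \<omega> - x)))
              \<le> (\<integral>u. (K u)\<^sup>2 \<partial>lborel) / f 0 * quantile (chi_square CARD('s)) (1 - \<alpha>)}"
    and C_event: "\<And>n. n \<ge> 1 \<Longrightarrow> {\<omega> \<in> space M. \<mu> \<in> C n \<omega>} \<in> sets M"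
  shows "(\<lambda>n. measure M {\<omega> \<in> space M. \<mu> \<in> C n \<omega>}) \<longlonglongrightarrow> 1 - \<alpha>"
proof -
  interpret prob_space M by fact
  note [measurable] = Y_rv
  have X_rv [measurable]: "X i \<in> borel_measurable M" if "i \<ge> 1" for i
    using distributed_measurable[OF X_density[OF that]] by simp
  have f_meas [measurable]: "f \<in> borel_measurable borel"
    using distributed_real_measurable[OF _ X_density[of 1]] f_nonneg by simp
  have K_meas [measurable]: "K \<in> borel_measurable borel" using K_integrable by auto
  obtain k where k: "\<And>u. K u \<le> k" using K_bounded K_nonneg by (auto simp: bounded_iff)
  define c2 where "c2 = (\<integral>u. (K u)\<^sup>2 \<partial>lborel)"
  define c where "c = c2 / f 0"
  have "c2 \<noteq> 0"
  proof
    assume "c2 = 0"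
    then have K0: "AE u in lborel. (K u)\<^sup>2 = 0"
      unfolding c2_def using K_square_integrable by (subst (asm) integral_nonneg_eq_0_iff_AE) auto
    have "(\<integral>u. K u \<partial>lborel) = (\<integral>u. 0 \<partial>(lborel :: real measure))" by (rule Bochner_Integration.integral_cong_AE) (use K0 in auto)
    then show False using K_integral by simp
  qed
  then have c2: "c2 > 0" by (simp add: c2_def order_less_le)
  then have c: "c > 0" using f_pos by (simp add: c_def)
  define S where "S = (\<integral>\<omega>. outer (Y 1 \<omega>) (Y 1 \<omega>) \<partial>M)"
  have S: "pos_definite S" using Y_pos_definite by (simp add: S_def)
  obtain b where b: "quad_orthonormal S b" using ex_quad_orthonormal[OF S] by blast
  have inner_meas: "(\<lambda>\<omega>. u \<bullet> Y i \<omega>) \<in> borel_measurable M" for u i by simp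

  \<comment> \<open>Asymptotics of the kernel moments and of the weights\<close>
  define p where "p n = expectation (\<lambda>\<omega>. K (X 1 \<omega> / h n))" for n
  define p2 where "p2 n = expectation (\<lambda>\<omega>. (K (X 1 \<omega> / h n))\<^sup>2)" for n
  have K_int: "integrable M (\<lambda>\<omega>. K (X i \<omega> / h n))" "integrable M (\<lambda>\<omega>. (K (X i \<omega> / h n))\<^sup>2)" if "i \<ge> 1" for i n
  proof -
    note [measurable] = X_rv[OF that]
    show "integrable M (\<lambda>\<omega>. K (X i \<omega> / h n))"
      by (rule integrable_const_bound[of _ k]) (use k K_nonneg in auto)
    show "integrable M (\<lambda>\<omega>. (K (X i \<omega> / h n))\<^sup>2)"
      by (rule integrable_const_bound[of _ "k\<^sup>2"]) (use k K_nonneg in \<open>auto intro!: power_mono\<close>)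
  qed
  have p: "expectation (\<lambda>\<omega>. K (X i \<omega> / h n)) = p n" if "i \<ge> 1" for i n
    unfolding p_def using expectation_kernel[OF X_density[OF that] f_nonneg K_meas] expectation_kernel[OF X_density[of 1] f_nonneg K_meas] by simp
  have p2: "expectation (\<lambda>\<omega>. (K (X i \<omega> / h n))\<^sup>2) = p2 n" if "i \<ge> 1" for i n
    unfolding p2_def using expectation_kernel[OF X_density[OF that] f_nonneg, of "\<lambda>u. (K u)\<^sup>2"]
      expectation_kernel[OF X_density[of 1] f_nonneg, of "\<lambda>u. (K u)\<^sup>2"] by simp
  have p_bounds: "0 \<le> p n" "p n \<le> k" for n
  proof -
    show "0 \<le> p n" unfolding p_def using K_nonneg by simp
    have "p n \<le> expectation (\<lambda>\<omega>. k)"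
      unfolding p_def using k by (intro integral_mono K_int) auto
    then show "p n \<le> k" by (simp add: prob_space)
  qed
  have p_lim: "(\<lambda>n. p n / h n) \<longlonglongrightarrow> f 0"
    using approximate_identity_tendsto[OF f_meas f_bounded f_cont K_integrable h_lim h_pos]
    unfolding p_def expectation_kernel[OF X_density[OF order_refl] f_nonneg K_meas] K_integral by simp
  have p2_lim: "(\<lambda>n. p2 n / h n) \<longlonglongrightarrow> f 0 * c2"
    using approximate_identity_tendsto[OF f_meas f_bounded f_cont K_square_integrable h_lim h_pos]
    unfolding p2_def c2_def
      expectation_kernel[OF X_density[OF order_refl] f_nonneg borel_measurable_power[OF K_meas]] .
  have p_pos: "eventually (\<lambda>n. p n > 0) sequentially"
    using order_tendstoD(1)[OF p_lim f_pos] eventually_ge_at_top[of 1]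
  proof eventually_elim
    case (elim n)
    then show ?case using h_pos[of n] by (simp add: zero_less_divide_iff)
  qed
  have hp_lim: "(\<lambda>n. h n / p n) \<longlonglongrightarrow> 1 / f 0"
    using tendsto_divide[OF tendsto_const[of 1] p_lim] f_pos by simp

  \<comment> \<open>The coefficient of \<open>K (X i / h n) * Y i\<close> in the rescaled estimator;
    \<open>\<xi>\<close> is the centred weight. Where \<open>p n = 0\<close>, division by zero gives
    \<open>\<kappa> n = 0\<close>, so the bounds and moments below hold for all
    \<open>n \<ge> 1\<close>.\<close>
  define \<kappa> where "\<kappa> n = sqrt (real n * h n) / (real n * p n)" for n
  define \<xi> where "\<xi> n i \<omega> = \<kappa> n * (K (X i \<omega> / h n) - p n)" for n i \<omega>
  define v where "v n = (\<kappa> n)\<^sup>2 * (p2 n - (p n)\<^sup>2)" for n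
  have nh: "real n * h n > 0" if "n \<ge> 1" for n using that h_pos[OF that] by simp
  have \<kappa>0: "\<kappa> n \<ge> 0" if "n \<ge> 1" for n using nh[OF that] p_bounds[of n] by (simp add: \<kappa>_def)
  have \<xi>_bound: "\<bar>\<xi> n i \<omega>\<bar> \<le> \<kappa> n * k" if "n \<ge> 1" for n i \<omega>
  proof -
    have "\<bar>K (X i \<omega> / h n) - p n\<bar> \<le> k"
      using K_nonneg[of "X i \<omega> / h n"] k[of "X i \<omega> / h n"] p_bounds[of n] by linarith
    then show ?thesis using \<kappa>0[OF that] by (simp add: \<xi>_def abs_mult mult_left_mono)
  qed
  have \<xi>_mean: "expectation (\<xi> n i) = 0" if "i \<ge> 1" for n i
    using K_int(1)[OF that] by (simp add: \<xi>_def[abs_def] p[OF that] prob_space)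
  have \<xi>_var: "expectation (\<lambda>\<omega>. (\<xi> n i \<omega>)\<^sup>2) = v n" if "i \<ge> 1" for n i
  proof -
    have "variance (\<lambda>\<omega>. K (X i \<omega> / h n)) = p2 n - (p n)\<^sup>2"
      using K_int[OF that, of n] by (subst variance_eq) (simp_all add: p[OF that] p2[OF that])
    then show ?thesis by (simp add: \<xi>_def power_mult_distrib v_def p[OF that])
  qed
  \<comment> \<open>Here \<open>\<kappa> n\<close> is \<open>h n / p n\<close> divided by
    \<open>sqrt (n h)\<close>: the quotient converges and the divisor tends to infinity.\<close>
  have \<kappa>_lim: "(\<lambda>n. \<kappa> n * k) \<longlonglongrightarrow> 0"
  proof -
    have "(\<lambda>n. h n / p n * (inverse (sqrt (real n * h n))) * k) \<longlonglongrightarrow> 1 / f 0 * 0 * k"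
      by (intro tendsto_mult hp_lim tendsto_const tendsto_inverse_0_at_top filterlim_compose[OF sqrt_at_top nh_lim])
    moreover have "eventually (\<lambda>n. h n / p n * (inverse (sqrt (real n * h n))) * k = \<kappa> n * k) sequentially"
      using eventually_ge_at_top[of 1]
    proof eventually_elim
      case (elim n)
      define s where "s = sqrt (real n * h n)"
      have s: "s \<noteq> 0" "s * s = real n * h n" using elim h_pos[OF elim] by (simp_all add: s_def)
      then have h: "h n = s * s / real n" using elim by simp
      have "h n / p n * inverse s * k = s / (real n * p n) * k"
        unfolding h using s(1) by simp
      then show ?case by (simp add: \<kappa>_def s_def)
    qed
    ultimately show ?thesis by (simp add: filterlim_cong)
  qed
  \<comment> \<open>As \<open>n * \<kappa>^2 = h / p^2\<close>, the squared mean contributes exactly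
    \<open>h n\<close>, which vanishes; the second moment contributes
    \<open>(1 / f 0)^2 * (f 0 * c2) = c\<close>.\<close>
  have v_lim: "(\<lambda>n. real n * v n) \<longlonglongrightarrow> c"
  proof -
    have "(\<lambda>n. (h n / p n)\<^sup>2 * (p2 n / h n) - h n) \<longlonglongrightarrow> (1 / f 0)\<^sup>2 * (f 0 * c2) - 0"
      by (intro tendsto_intros hp_lim p2_lim h_lim)
    also have "(1 / f 0)\<^sup>2 * (f 0 * c2) - 0 = c" using f_pos by (simp add: c_def power2_eq_square)
    finally have "(\<lambda>n. (h n / p n)\<^sup>2 * (p2 n / h n) - h n) \<longlonglongrightarrow> c" .
    moreover have "eventually (\<lambda>n. (h n / p n)\<^sup>2 * (p2 n / h n) - h n = real n * v n) sequentially"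
      using eventually_ge_at_top[of 1] p_pos
    proof eventually_elim
      case (elim n)
      have "(sqrt (real n * h n))\<^sup>2 = real n * h n" using nh[OF elim(1)] by simp
      then have "(\<kappa> n)\<^sup>2 = real n * h n / (real n * p n)\<^sup>2" by (simp add: \<kappa>_def power_divide)
      then show ?case using h_pos[OF elim(1)] elim by (simp add: v_def power2_eq_square field_simps)
    qed
    ultimately show ?thesis by (simp add: filterlim_cong)
  qed

  \<comment> \<open>Moments of \<open>Y\<close>, the bias, and the rescaled error in a
    direction\<close>
  have Y_distr: "distr M borel (Y i) = distr M borel (Y j)" for i j
    by (rule stationary_seq_distr[OF Y_rv Y_stationary])
  have Y_sq: "integrable M (\<lambda>\<omega>. (norm (Y i \<omega>))\<^sup>2)" for i
    using integrable_distr_eq[of "Y i" M borel "\<lambda>y. (norm y)\<^sup>2"] integrable_distr_eq[of "Y 1" M borel "\<lambda>y. (norm y)\<^sup>2"]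
      Y_distr[of i 1] Y_square_integrable by simp
  have Y_int: "integrable M (Y i)" for i
  proof -
    have "integrable M (\<lambda>\<omega>. norm (Y i \<omega>))"
      by (rule square_integrable_imp_integrable[OF _ Y_sq]) simp
    then show ?thesis by (subst (asm) integrable_norm_iff) auto
  qed
  have Y_mean: "expectation (Y i) = \<mu>" for i
  proof -
    have "expectation (Y i) = (\<integral>y. y \<partial>distr M borel (Y i))" by (rule integral_distr[symmetric]) simp_all
    also have "\<dots> = (\<integral>y. y \<partial>distr M borel (Y 1))" by (simp only: Y_distr[of i 1])
    also have "\<dots> = \<mu>" unfolding mean by (rule integral_distr) simp_all
    finally show ?thesis .
  qed
  have CS: "(u \<bullet> x)\<^sup>2 \<le> (norm u)\<^sup>2 * (norm x)\<^sup>2" for u x :: "real^'s"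
    using Cauchy_Schwarz_ineq[of u x] by (simp add: power2_norm_eq_inner)
  have inner_sq: "integrable M (\<lambda>\<omega>. (u \<bullet> Y i \<omega>)\<^sup>2)" for u i
  proof (rule Bochner_Integration.integrable_bound)
    show "integrable M (\<lambda>\<omega>. (norm u)\<^sup>2 * (norm (Y i \<omega>))\<^sup>2)" using Y_sq by simp
    show "AE \<omega> in M. norm ((u \<bullet> Y i \<omega>)\<^sup>2) \<le> norm ((norm u)\<^sup>2 * (norm (Y i \<omega>))\<^sup>2)"
      by (intro AE_I2) (simp add: CS)
  qed simp

  define Yb where "Yb n \<omega> = (1 / real n) *\<^sub>R (\<Sum>i=1..n. Y (int i) \<omega>)" for n \<omega>
  have Yb_meas [measurable]: "Yb n \<in> borel_measurable M" for n unfolding Yb_def[abs_def] by simp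
  have Yb_sq: "integrable M (\<lambda>\<omega>. (norm (Yb n \<omega>))\<^sup>2)" for n
    using square_integrable_sum[of "{1..n}" "\<lambda>i. Y (int i)" M] Y_sq by (simp add: Yb_def power_mult_distrib power_divide)
  have Yb_mean: "expectation (Yb n) = \<mu>" if "n \<ge> 1" for n
    using that Y_int by (simp add: Yb_def[abs_def] Bochner_Integration.integral_sum Y_mean sum_constant_scaleR del: sum_constant)
  \<comment> \<open>What remains when each weight is replaced by its mean; after centring at
    \<open>\<mu>\<close> it is the rescaled error of the sample mean of \<open>Y\<close>.\<close>
  define bias where "bias u n \<omega> = sqrt (real n * h n) * (u \<bullet> (Yb n \<omega> - \<mu>))" for u n \<omega>
  have bias_lim: "(\<lambda>n. sqrt (expectation (\<lambda>\<omega>. (bias u n \<omega>)\<^sup>2))) \<longlonglongrightarrow> 0" for u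
  proof (rule Lim_null_comparison)
    have "(\<lambda>n. sqrt ((real n * h n * lambda_max (cov_matrix M (Yb n))) * (u \<bullet> u))) \<longlonglongrightarrow> sqrt (0 * (u \<bullet> u))"
      using cov_lim unfolding Yb_def[abs_def] by (intro tendsto_intros)
    then show "(\<lambda>n. sqrt ((real n * h n * lambda_max (cov_matrix M (Yb n))) * (u \<bullet> u))) \<longlonglongrightarrow> 0" by simp
    show "eventually (\<lambda>n. norm (sqrt (expectation (\<lambda>\<omega>. (bias u n \<omega>)\<^sup>2))) \<le> sqrt ((real n * h n * lambda_max (cov_matrix M (Yb n))) * (u \<bullet> u))) sequentially"
      using eventually_ge_at_top[of 1]
    proof eventually_elim
      case (elim n)
      have "expectation (\<lambda>\<omega>. (bias u n \<omega>)\<^sup>2) = real n * h n * expectation (\<lambda>\<omega>. (u \<bullet> (Yb n \<omega> - \<mu>))\<^sup>2)"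
        using nh[OF elim] by (simp add: bias_def power_mult_distrib)
      also have "\<dots> \<le> real n * h n * (lambda_max (cov_matrix M (Yb n)) * (u \<bullet> u))"
        using variance_inner_le_lambda_max[OF Yb_meas Yb_sq, of u n] nh[OF elim] Yb_mean[OF elim]
        by (intro mult_left_mono) simp_all
      finally show ?case by (simp add: mult.assoc)
    qed
  qed

  define w where "w n \<omega> = sqrt (real n * h n) *\<^sub>R (r_hat M K h X Y n \<omega> - \<mu>)" for n \<omega>
  have r_hat: "r_hat M K h X Y n \<omega> = (1 / (real n * p n)) *\<^sub>R (\<Sum>i=1..n. K (X i \<omega> / h n) *\<^sub>R Y (int i) \<omega>)" for n \<omega>
    by (simp add: r_hat_def p_def)
  have w_meas [measurable]: "w n \<in> borel_measurable M" for n
    unfolding w_def[abs_def] r_hat by (intro borel_measurable_scaleR borel_measurable_diff borel_measurable_sum) measurable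
  \<comment> \<open>Positivity of \<open>p n\<close> ensures
    \<open>\<kappa> n * p n = sqrt (n h) / n\<close>; it holds eventually, which is enough for
    limits.\<close>
  have w_eq: "u \<bullet> w n \<omega> = (\<Sum>i=1..n. (u \<bullet> Y (int i) \<omega>) * \<xi> n i \<omega>) + bias u n \<omega>" if "n \<ge> 1" "p n > 0" for u n \<omega>
  proof -
    have "(\<Sum>i=1..n. (u \<bullet> Y (int i) \<omega>) * \<xi> n i \<omega>) = \<kappa> n * (\<Sum>i=1..n. K (X i \<omega> / h n) * (u \<bullet> Y (int i) \<omega>)) - \<kappa> n * p n * (\<Sum>i=1..n. u \<bullet> Y (int i) \<omega>)"
      by (simp add: \<xi>_def sum_distrib_left sum_subtractf[symmetric] algebra_simps)
    moreover have "\<kappa> n * p n = sqrt (real n * h n) / real n" using that by (simp add: \<kappa>_def)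
    moreover have "u \<bullet> w n \<omega> = \<kappa> n * (\<Sum>i=1..n. K (X i \<omega> / h n) * (u \<bullet> Y (int i) \<omega>)) - sqrt (real n * h n) * (u \<bullet> \<mu>)"
      by (simp add: w_def r_hat \<kappa>_def inner_diff_right inner_sum_right right_diff_distrib)
    moreover have "bias u n \<omega> = sqrt (real n * h n) / real n * (\<Sum>i=1..n. u \<bullet> Y (int i) \<omega>) - sqrt (real n * h n) * (u \<bullet> \<mu>)"
      by (simp add: bias_def Yb_def inner_diff_right inner_sum_right right_diff_distrib)
    ultimately show ?thesis by simp
  qed

  have char_w: "(\<lambda>n. CLINT \<omega>|M. iexp (u \<bullet> w n \<omega>)) \<longlonglongrightarrow> exp (- (c * (u \<bullet> (S *v u)) / 2))" for u
  proof -
    define A where "A = (\<integral>\<omega>. (u \<bullet> Y 1 \<omega>)\<^sup>2 \<partial>M)"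
    have A: "A = u \<bullet> (S *v u)" unfolding A_def S_def by (rule quad_form_integral_outer[symmetric]) (simp_all add: Y_sq)
    define T where "T n \<omega> = (\<Sum>i=1..n. (u \<bullet> Y (int i) \<omega>) * \<xi> n i \<omega>)" for n \<omega>
    have \<phi>_meas [measurable]: "(\<lambda>x. \<kappa> n * (K (x / h n) - p n)) \<in> borel_measurable borel" for n by measurable
    have \<xi>_meas: "\<xi> n i \<in> borel_measurable M" if "i \<ge> 1" for n i
      unfolding \<xi>_def[abs_def] using measurable_compose[OF X_rv[OF that] \<phi>_meas] by simp
    have "(\<lambda>n. CLINT \<omega>|M. iexp (\<Sum>i=1..n. (\<lambda>i \<omega>. u \<bullet> Y (int i) \<omega>) i \<omega> * \<xi> n i \<omega>)) \<longlonglongrightarrow> exp (- (c * A / 2))"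
    proof (rule weighted_triangular_clt[where e = "\<lambda>n. \<kappa> n * k" and v = v])
      show "indep_vars (\<lambda>_. borel) (\<xi> n) {1..n}" for n
        using indep_vars_compose2[OF indep_vars_subset[OF X_indep, of "{1..n}"], of "\<lambda>_ x. \<kappa> n * (K (x / h n) - p n)" "\<lambda>_. borel"]
        by (simp add: \<xi>_def[abs_def])
      show "indep_var (Pi\<^sub>M {1..n} (\<lambda>_. borel)) (\<lambda>\<omega>. \<lambda>i\<in>{1..n}. \<xi> n i \<omega>) (Pi\<^sub>M {1..n} (\<lambda>_. borel)) (\<lambda>\<omega>. \<lambda>i\<in>{1..n}. u \<bullet> Y (int i) \<omega>)" for n
        unfolding \<xi>_def by (rule indep_seqs_imp_indep_var[OF X_Y_indep X_rv Y_rv \<phi>_meas]) simp_all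
      show "distr M borel (\<lambda>\<omega>. u \<bullet> Y (int i) \<omega>) = distr M borel (\<lambda>\<omega>. u \<bullet> Y (int 1) \<omega>)" for i
        using distr_distr[of "\<lambda>y. u \<bullet> y" borel borel "Y (int i)" M] distr_distr[of "\<lambda>y. u \<bullet> y" borel borel "Y 1" M] Y_distr[of "int i" 1]
        by (simp add: comp_def)
      show "AE \<omega> in M. (\<lambda>n. (\<Sum>i=1..n. (u \<bullet> Y (int i) \<omega>)\<^sup>2) / n) \<longlonglongrightarrow> A"
        unfolding A_def by (rule stationary_ergodic_averages[OF \<open>prob_space M\<close> Y_rv Y_stationary Y_ergodic]) (simp_all add: inner_sq)
      show "integrable M (\<lambda>\<omega>. (u \<bullet> Y (int 1) \<omega>)\<^sup>2)" by (rule inner_sq)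
    qed (use \<xi>_bound \<xi>_mean \<xi>_var \<kappa>_lim v_lim in simp_all)
    then have T_lim: "(\<lambda>n. CLINT \<omega>|M. iexp (T n \<omega>)) \<longlonglongrightarrow> exp (- (c * A / 2))" by (simp add: T_def)
    have "(\<lambda>n. (CLINT \<omega>|M. iexp (u \<bullet> w n \<omega>)) - (CLINT \<omega>|M. iexp (T n \<omega>))) \<longlonglongrightarrow> 0"
    proof (rule Lim_null_comparison[OF _ bias_lim[of u]])
      show "eventually (\<lambda>n. norm ((CLINT \<omega>|M. iexp (u \<bullet> w n \<omega>)) - (CLINT \<omega>|M. iexp (T n \<omega>))) \<le> sqrt (expectation (\<lambda>\<omega>. (bias u n \<omega>)\<^sup>2))) sequentially"
        using eventually_ge_at_top[of 1] p_pos
      proof eventually_elim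
        case (elim n)
        have "u \<bullet> w n \<omega> = T n \<omega> + bias u n \<omega>" for \<omega> unfolding T_def by (rule w_eq[OF elim])
        moreover have "cmod ((CLINT \<omega>|M. iexp (T n \<omega> + bias u n \<omega>)) - (CLINT \<omega>|M. iexp (T n \<omega>))) \<le> sqrt (expectation (\<lambda>\<omega>. (bias u n \<omega>)\<^sup>2))"
        proof (rule iexp_perturb)
          show "T n \<in> borel_measurable M" unfolding T_def[abs_def]
            by (intro borel_measurable_sum borel_measurable_times \<xi>_meas inner_meas) simp
          show "bias u n \<in> borel_measurable M" unfolding bias_def[abs_def] by measurable
          have "integrable M (\<lambda>\<omega>. (norm (Yb n \<omega> + (- \<mu>)))\<^sup>2)"
            by (rule square_integrable_add) (simp_all add: Yb_sq)
          then have "integrable M (\<lambda>\<omega>. (sqrt (real n * h n))\<^sup>2 * ((norm u)\<^sup>2 * (norm (Yb n \<omega> - \<mu>))\<^sup>2))" by simp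
          then show "integrable M (\<lambda>\<omega>. (bias u n \<omega>)\<^sup>2)"
          proof (rule Bochner_Integration.integrable_bound)
            show "(\<lambda>\<omega>. (bias u n \<omega>)\<^sup>2) \<in> borel_measurable M" unfolding bias_def by measurable
            show "AE \<omega> in M. norm ((bias u n \<omega>)\<^sup>2) \<le> norm ((sqrt (real n * h n))\<^sup>2 * ((norm u)\<^sup>2 * (norm (Yb n \<omega> - \<mu>))\<^sup>2))"
              by (intro AE_I2) (simp add: bias_def power_mult_distrib abs_mult mult_left_mono CS)
          qed
        qed
        ultimately show ?case by simp
      qed
    qed
    from tendsto_add[OF this T_lim] show ?thesis by (simp add: A)
  qed

  \<comment> \<open>Coordinates with a standard normal limit: the sum of their squares is the
    inverse quadratic form of \<open>S\<close> at \<open>w n\<close>, divided by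
    \<open>c\<close>.\<close>
  define Z where "Z n j \<omega> = (b j \<bullet> w n \<omega>) / sqrt c" for n j \<omega>
  have Z_meas [measurable]: "Z n j \<in> borel_measurable M" for n j unfolding Z_def[abs_def] by measurable
  define V where "V n \<omega> = (\<Sum>j<CARD('s). (Z n j \<omega>)\<^sup>2)" for n \<omega>
  have V_meas [measurable]: "V n \<in> borel_measurable M" for n unfolding V_def[abs_def] by measurable
  have cV: "(\<Sum>j<CARD('s). (b j \<bullet> w n \<omega>)\<^sup>2) = c * V n \<omega>" for n \<omega>
    using c by (simp add: V_def Z_def power_divide sum_divide_distrib[symmetric])
  have "weak_conv_m (\<lambda>n. distr M borel (\<lambda>\<omega>. \<Sum>j<CARD('s). (Z n j \<omega>)\<^sup>2)) (chi_square CARD('s))"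
  proof (rule weak_conv_chi_square[OF Z_meas])
    fix g :: "nat \<Rightarrow> real"
    \<comment> \<open>Orthonormality of \<open>b\<close> for \<open>S\<close> makes
      \<open>c * (u \<bullet> (S *v u))\<close> the sum of the squares of \<open>g\<close>, so the
      limits in single directions supply the joint characteristic function.\<close>
    define u where "u = (\<Sum>j<CARD('s). (g j / sqrt c) *\<^sub>R b j)"
    have "(\<Sum>j<CARD('s). g j * Z n j \<omega>) = u \<bullet> w n \<omega>" for n \<omega>
      by (simp add: u_def Z_def inner_sum_left)
    moreover have "c * (u \<bullet> (S *v u)) = (\<Sum>j<CARD('s). (g j)\<^sup>2)"
    proof -
      have Su: "S *v u = (\<Sum>j<CARD('s). (g j / sqrt c) *\<^sub>R (S *v b j))"
        by (simp add: u_def linear_sum[OF matrix_vector_mul_linear] matrix_vector_mult_scaleR o_def)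
      have "b i \<bullet> (S *v u) = g i / sqrt c" if "i < CARD('s)" for i
        using that b by (simp add: Su inner_sum_right quad_orthonormal_def if_distrib[of "\<lambda>x. _ * x"] cong: if_cong)
      then have "u \<bullet> (S *v u) = (\<Sum>j<CARD('s). (g j / sqrt c) * (g j / sqrt c))"
        by (simp add: u_def inner_sum_left)
      then show ?thesis using c by (simp add: sum_distrib_left power2_eq_square)
    qed
    ultimately show "(\<lambda>n. CLINT \<omega>|M. iexp (\<Sum>j<CARD('s). g j * Z n j \<omega>)) \<longlonglongrightarrow> exp (- (\<Sum>j<CARD('s). (g j)\<^sup>2) / 2)"
      using char_w[of u] by (simp only: minus_divide_left)
  qed
  then have V_lim: "(\<lambda>n. prob {\<omega> \<in> space M. V n \<omega> \<le> x}) \<longlonglongrightarrow> cdf (chi_square CARD('s)) x" for x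
  proof -
    have "cdf (distr M borel (V n)) x = prob {\<omega> \<in> space M. V n \<omega> \<le> x}" for n
      unfolding cdf_def by (subst measure_distr) (auto intro!: arg_cong[where f=prob])
    moreover have "(\<lambda>n. cdf (distr M borel (V n)) x) \<longlonglongrightarrow> cdf (chi_square CARD('s)) x"
      using \<open>weak_conv_m _ _\<close> isCont_cdf_chi_square[of "CARD('s)" x]
      by (simp add: weak_conv_m_def weak_conv_def V_def[abs_def])
    ultimately show ?thesis by simp
  qed

  interpret chi: real_distribution "chi_square CARD('s)" by (rule real_distribution_chi_square)
  define q where "q = quantile (chi_square CARD('s)) (1 - \<alpha>)"
  have F_q: "cdf (chi_square CARD('s)) q = 1 - \<alpha>"
    unfolding q_def by (rule chi.cdf_quantile) (use alpha isCont_cdf_chi_square in auto)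
  \<comment> \<open>As \<open>V\<close> is nonnegative, its limit law gives no mass below 0, whereas
    the cdf at \<open>q\<close> is \<open>1 - \<alpha> > 0\<close>. The sign of \<open>q\<close>
    orders the two thresholds in the sandwich.\<close>
  have "q \<ge> 0"
  proof (rule ccontr)
    assume "\<not> q \<ge> 0"
    have "0 \<le> V n \<omega>" for n \<omega> by (simp add: V_def sum_nonneg)
    then have "{\<omega> \<in> space M. V n \<omega> \<le> q} = {}" for n
      using \<open>\<not> q \<ge> 0\<close> by (auto simp: not_le intro: less_le_trans)
    then have "(\<lambda>n. 0) \<longlonglongrightarrow> cdf (chi_square CARD('s)) q" using V_lim[of q] by (simp only: measure_empty)
    then have "cdf (chi_square CARD('s)) q = 0" by (simp add: LIMSEQ_const_iff)
    then show False using F_q alpha by simp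
  qed

  have Sigma_meas [measurable]: "Sigma_hat Y n \<in> borel_measurable M" for n
    unfolding Sigma_hat_def[abs_def] by measurable
  have Sigma_sym: "transpose (Sigma_hat Y n \<omega>) = Sigma_hat Y n \<omega>" for n \<omega>
    by (simp add: Sigma_hat_def transpose_def outer_def vec_eq_iff mult.commute)
  have "(\<lambda>n. prob {\<omega> \<in> space M. \<mu> \<in> C n \<omega>}) \<longlonglongrightarrow> cdf (chi_square CARD('s)) q"
  proof (rule tendsto_prob_sandwich[OF V_meas V_lim isCont_cdf_chi_square \<open>q \<ge> 0\<close>])
    show "eventually (\<lambda>n. {\<omega> \<in> space M. \<mu> \<in> C n \<omega>} \<in> events) sequentially"
      using eventually_ge_at_top[of 1] by eventually_elim (rule C_event)
    fix d :: real assume d: "0 < d" "d < 1"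
    obtain e where e: "e > 0"
      and close: "\<And>A v. norm (A - S) \<le> e \<Longrightarrow> \<bar>v \<bullet> (A *v v) - v \<bullet> (S *v v)\<bar> \<le> d * (v \<bullet> (S *v v))"
      using quad_form_close[OF S d(1)] by blast
    \<comment> \<open>Outside \<open>B n\<close> the matrix \<open>Sigma_hat\<close> is close to
      \<open>S\<close> and therefore invertible, so \<open>C_region\<close> applies and the
      arbitrary choice of the region on singular samples is confined to an event of vanishing
      probability.\<close>
    define B where "B n = {\<omega> \<in> space M. e < norm (Sigma_hat Y n \<omega> - S)}" for n
    have "(\<lambda>n. prob (B n)) \<longlonglongrightarrow> 0" unfolding B_def
      by (rule tendsto_AE_imp_tendsto_prob[OF Sigma_meas _ e])
         (unfold S_def, rule Sigma_hat_tendsto[OF \<open>prob_space M\<close> Y_rv Y_stationary Y_ergodic Y_square_integrable])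
    moreover have "B n \<in> events" for n unfolding B_def by measurable
    moreover have "eventually (\<lambda>n. \<forall>\<omega>\<in>space M - B n.
        (\<omega> \<in> {\<omega> \<in> space M. \<mu> \<in> C n \<omega>} \<longrightarrow> V n \<omega> \<le> (1 + d) * q) \<and>
        (V n \<omega> \<le> (1 - d) * q \<longrightarrow> \<omega> \<in> {\<omega> \<in> space M. \<mu> \<in> C n \<omega>})) sequentially"
      using eventually_ge_at_top[of 1]
    proof eventually_elim
      case (elim n)
      show ?case
      proof
        fix \<omega> assume \<omega>: "\<omega> \<in> space M - B n"
        let ?A = "Sigma_hat Y n \<omega>"
        have A: "norm (?A - S) \<le> e" using \<omega> by (simp add: B_def not_less)
        define Q where "Q = w n \<omega> \<bullet> (matrix_inv ?A *v w n \<omega>)"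
        note sw = quad_inverse_sandwich[OF S b less_imp_le[OF d(1)] d(2) close[OF A]]
        have lo: "(1 - d) * Q \<le> c * V n \<omega>" using sw(2)[of "w n \<omega>"] by (simp add: Q_def cV)
        have up: "c * V n \<omega> \<le> (1 + d) * Q" using sw(3)[OF Sigma_sym, of "w n \<omega>"] by (simp add: Q_def cV)
        have Q: "real n * h n * ((r_hat M K h X Y n \<omega> - \<mu>) \<bullet> (matrix_inv ?A *v (r_hat M K h X Y n \<omega> - \<mu>))) = Q"
          using nh[OF elim] by (simp add: Q_def w_def matrix_vector_mult_scaleR)
        have "\<mu> \<in> C n \<omega> \<longleftrightarrow> Q \<le> c * q"
          using C_region[OF elim _ sw(1)] \<omega> by (simp add: Q q_def c_def c2_def)
        moreover have "V n \<omega> \<le> (1 + d) * q" if "Q \<le> c * q"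
        proof -
          have "c * V n \<omega> \<le> (1 + d) * (c * q)" using up that d by (meson add_nonneg_nonneg less_imp_le mult_left_mono order_trans zero_le_one)
          then have "c * V n \<omega> \<le> c * ((1 + d) * q)" by (simp add: mult_ac)
          then show ?thesis using c by simp
        qed
        moreover have "Q \<le> c * q" if "V n \<omega> \<le> (1 - d) * q"
        proof -
          have "(1 - d) * Q \<le> c * ((1 - d) * q)" using lo that c by (meson less_imp_le mult_left_mono order_trans)
          then have "(1 - d) * Q \<le> (1 - d) * (c * q)" by (simp add: mult_ac)
          then show ?thesis using d by simp
        qed
        ultimately show "(\<omega> \<in> {\<omega> \<in> space M. \<mu> \<in> C n \<omega>} \<longrightarrow> V n \<omega> \<le> (1 + d) * q) \<and>
            (V n \<omega> \<le> (1 - d) * q \<longrightarrow> \<omega> \<in> {\<omega> \<in> space M. \<mu> \<in> C n \<omega>})"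
          using \<omega> by auto
      qed
    qed
    ultimately show "\<exists>B. (\<forall>n. B n \<in> events) \<and> (\<lambda>n. prob (B n)) \<longlonglongrightarrow> 0 \<and>
       eventually (\<lambda>n. \<forall>\<omega>\<in>space M - B n. (\<omega> \<in> {\<omega> \<in> space M. \<mu> \<in> C n \<omega>} \<longrightarrow> V n \<omega> \<le> (1 + d) * q) \<and>
         (V n \<omega> \<le> (1 - d) * q \<longrightarrow> \<omega> \<in> {\<omega> \<in> space M. \<mu> \<in> C n \<omega>})) sequentially"
      by blast
  qed simp
  then show ?thesis by (simp add: F_q)
qed

end
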